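(* Let $d\ge1$, let $w_1,\dots,w_d\in\mathbb C$ satisfy $\Re(w_i)>0$ for $i=1,\dots,d$, put $\bm w=(w_1,\dots,w_d)$, and let $q\in\{1,\dots,d\}$. Then $$\begin{aligned} F.P.[\zeta_{\rm Bh}(\alpha|\bm w)]_{\alpha=q}={}&\frac{1}{\bigl(\prod_{i=1}^dw_i\bigr)(q-1)!}\Biggl[\frac{(-1)^{d-q+1}B_{d-q}(\bm w)H_{q-1}}{(d-q)!}+\sum_{j=0}^{d-q-1}\frac{(-1)^{j+1}B_j(\bm w)}{j!\,(d-q-j)!\,(d-q-j)}\Biggr]\\ &+J_{d-q,1}(q|\bm w), \end{aligned}$$ where $$J_{d-q,1}(q|\bm w)=\frac{1}{\Gamma(q)}\int_0^\infty t^{q-1}\Biggl(\frac{1}{\prod_{i=1}^d(1-{\rm e}^{-w_it})}-1-\frac{t^{-d}{\rm e}^{-t}}{\prod_{i=1}^dw_i}\sum_{k=0}^{d-q}(-1)^kB_k(-1|\bm w)\frac{t^k}{k!}\Biggr){\rm d}t .$$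
   Context: $\log$ is the principal branch on the right half-plane and $z^s=\exp(s\log z)$. $\mathbb N_0=\{0,1,2,\dots\}$, $\bm n\cdot\bm w=\sum_{i=1}^dn_iw_i$. Empty sums are zero. The homogeneous Barnes zeta function is $\zeta_{\rm Bh}(\alpha|\bm w)=\sum_{\bm n\in\mathbb N_0^d\setminus\{\bm 0\}}(\bm n\cdot\bm w)^{-\alpha}$ for $\Re(\alpha)>d$; it extends meromorphically in $\alpha$ to $\mathbb C$, with at most simple poles, located at $\alpha=1,\dots,d$. $F.P.[f(\alpha)]_{\alpha=q}$ denotes the constant term of the Laurent expansion of $f$ at $\alpha=q$. Harmonic numbers: $H_k=\sum_{i=1}^k1/i$, $H_0=0$. The higher order Bernoulli polynomials $B_n(x|\bm w)$ are defined by $z^d{\rm e}^{xz}\prod_{i=1}^d\frac{w_i}{{\rm e}^{w_iz}-1}=\sum_{n\ge0}B_n(x|\bm w)\frac{z^n}{n!}$ for $|z|<2\pi/\max_i|w_i|$, and the higher order Bernoulli numbers are $B_k(\bm w)=B_k(0|\bm w)$. *)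

theory Defs
  imports "HOL-Complex_Analysis.Complex_Analysis"
begin

text \<open>
  A parameter vector of length \<open>d\<close> is a function on \<open>nat\<close> of which only the values at
  \<open>1, \<dots>, d\<close> matter.
\<close>

definition multi_indices :: "nat \<Rightarrow> (nat \<Rightarrow> nat) set" where
  "multi_indices d = {1..d} \<rightarrow>\<^sub>E UNIV"

definition dot :: "nat \<Rightarrow> (nat \<Rightarrow> nat) \<Rightarrow> (nat \<Rightarrow> complex) \<Rightarrow> complex" where
  "dot d n w = (\<Sum>i=1..d. of_nat (n i) * w i)"

text \<open>The Dirichlet-type series, meaningful for \<open>Re \<alpha> > d\<close>; the zero multi-index is left out.\<close>

definition hom_barnes_series :: "nat \<Rightarrow> (nat \<Rightarrow> complex) \<Rightarrow> complex \<Rightarrow> complex" where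
  "hom_barnes_series d w \<alpha> =
     (\<Sum>\<^sub>\<infinity>n\<in>multi_indices d - {\<lambda>i\<in>{1..d}. 0}. dot d n w powr (-\<alpha>))"

text \<open>
  The meromorphic continuation to the whole plane. The library predicate
  \<open>nicely_meromorphic_on\<close> (limit value at removable singularities, value 0 at poles) is what
  makes the continuation unique as a total function.
\<close>

definition hom_barnes_zeta :: "nat \<Rightarrow> (nat \<Rightarrow> complex) \<Rightarrow> complex \<Rightarrow> complex" where
  "hom_barnes_zeta d w =
     (THE f. f nicely_meromorphic_on UNIV \<and>
             (\<forall>\<alpha>. Re \<alpha> > real d \<longrightarrow> f \<alpha> = hom_barnes_series d w \<alpha>))"

definition finite_part :: "(complex \<Rightarrow> complex) \<Rightarrow> complex \<Rightarrow> complex" where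
  "finite_part f z = fls_nth (laurent_expansion f z) 0"

text \<open>
  The generating function \<open>z\<^sup>d exp(xz) \<Prod> w\<^sub>i / (exp(w\<^sub>i z) - 1)\<close> as a formal power series. One
  factor \<open>z\<close> is put into each quotient, because \<open>exp(w\<^sub>i z) - 1\<close> has no constant term.
\<close>

definition bernoulli_fps :: "nat \<Rightarrow> (nat \<Rightarrow> complex) \<Rightarrow> complex \<Rightarrow> complex fps" where
  "bernoulli_fps d w x =
     fps_exp x * (\<Prod>i=1..d. fps_const (w i) * fps_X / (fps_exp (w i) - 1))"

definition bernoulli_poly :: "nat \<Rightarrow> (nat \<Rightarrow> complex) \<Rightarrow> nat \<Rightarrow> complex \<Rightarrow> complex" where
  "bernoulli_poly d w n x = fact n * fps_nth (bernoulli_fps d w x) n"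

definition bernoulli_num :: "nat \<Rightarrow> (nat \<Rightarrow> complex) \<Rightarrow> nat \<Rightarrow> complex" where
  "bernoulli_num d w k = bernoulli_poly d w k 0"

text \<open>The integrand of \<open>J\<^bsub>d-q,1\<^esub>(q|w)\<close>, meaningful for \<open>t > 0\<close> and \<open>1 \<le> q \<le> d\<close>.\<close>

definition J_integrand :: "nat \<Rightarrow> (nat \<Rightarrow> complex) \<Rightarrow> nat \<Rightarrow> real \<Rightarrow> complex" where
  "J_integrand d w q t =
     of_real t ^ (q - 1) *
       (1 / (\<Prod>i=1..d. 1 - exp (- (w i * of_real t))) - 1
        - of_real t powi (- int d) * exp (- of_real t) / (\<Prod>i=1..d. w i) *
          (\<Sum>k=0..d-q. (-1) ^ k * bernoulli_poly d w k (-1) * of_real t ^ k / fact k))"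

definition J_integral :: "nat \<Rightarrow> (nat \<Rightarrow> complex) \<Rightarrow> nat \<Rightarrow> complex" where
  "J_integral d w q =
     1 / Gamma (of_nat q) * set_lebesgue_integral lborel {0<..} (J_integrand d w q)"


text \<open>The analytic form of the generating function identity.\<close>

lemma bernoulli_factor_expansion:
  fixes w :: complex
  assumes "w \<noteq> 0"
  shows "(\<lambda>z. if z = 0 then 1 else w * z / (exp (w * z) - 1)) has_fps_expansion
           fps_const w * fps_X / (fps_exp w - 1)"
proof -
  have nz: "fps_nth (fps_exp w - 1) 1 \<noteq> 0"
    using assms by simp
  have sub: "subdegree (fps_exp w - 1) = 1"
    using nz by (intro subdegreeI) auto
  show ?thesis
    using assms nz sub
    by (intro has_fps_expansion_divide fps_expansion_intros) (auto simp: subdegree_mult)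
qed

lemma bernoulli_factor_holomorphic:
  fixes w :: complex
  assumes "w \<noteq> 0" "r \<le> 2 * pi / norm w"
  shows "(\<lambda>z. if z = 0 then 1 else w * z / (exp (w * z) - 1)) holomorphic_on ball 0 r"
    (is "?f holomorphic_on _")
proof -
  obtain s where s: "open s" "0 \<in> s" "?f holomorphic_on s"
    using has_fps_expansion_imp_holomorphic[OF bernoulli_factor_expansion[OF assms(1)]] by blast
  have nz: "exp (w * z) - 1 \<noteq> 0" if z: "z \<in> ball 0 r - {0}" for z
  proof
    assume "exp (w * z) - 1 = 0"
    then obtain n :: int where n: "Re (w * z) = 0" "Im (w * z) = of_int (2 * n) * pi"
      by (auto simp: exp_eq_1)
    have "w * z \<noteq> 0"
      using z assms by auto
    with n have "n \<noteq> 0"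
      by (auto simp: complex_eq_iff)
    then have "1 \<le> \<bar>real_of_int n\<bar>"
      by linarith
    then have "2 * pi * 1 \<le> 2 * pi * \<bar>real_of_int n\<bar>"
      by (intro mult_left_mono) auto
    also have "\<dots> = \<bar>Im (w * z)\<bar>"
      unfolding n by (simp add: abs_mult)
    also have "\<dots> \<le> norm w * norm z"
      using abs_Im_le_cmod[of "w * z"] by (simp only: norm_mult)
    also have "\<dots> < norm w * (2 * pi / norm w)"
      using z assms by (intro mult_strict_left_mono) auto
    finally show False
      using assms by simp
  qed
  have "(\<lambda>z. w * z / (exp (w * z) - 1)) holomorphic_on ball 0 r - {0}"
    using nz by (intro holomorphic_intros) auto
  then have "?f holomorphic_on ball 0 r - {0}"
    by (rule holomorphic_transform) auto
  then have "?f holomorphic_on s \<union> (ball 0 r - {0})"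
    using s by (intro holomorphic_on_Un) auto
  then show ?thesis
    using s by (elim holomorphic_on_subset) auto
qed

lemma bernoulli_poly_sums:
  assumes "\<And>i. i \<in> {1..d} \<Longrightarrow> w i \<noteq> 0"
    and "z \<noteq> 0"
    and "\<And>i. i \<in> {1..d} \<Longrightarrow> norm z < 2 * pi / norm (w i)"
  shows "(\<lambda>n. bernoulli_poly d w n x * z ^ n / fact n) sums
           (z ^ d * exp (x * z) * (\<Prod>i=1..d. w i / (exp (w i * z) - 1)))"
proof -
  define r where "r = Min (insert (norm z + 1) ((\<lambda>i. 2 * pi / norm (w i)) ` {1..d}))"
  have r: "norm z < r" "\<And>i. i \<in> {1..d} \<Longrightarrow> r \<le> 2 * pi / norm (w i)"
  proof -
    show "norm z < r"
      unfolding r_def using assms(3) by (subst Min_gr_iff) auto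
    show "r \<le> 2 * pi / norm (w i)" if "i \<in> {1..d}" for i
      unfolding r_def using that by (intro Min_le) auto
  qed
  let ?g = "\<lambda>i z. if z = 0 then 1 else w i * z / (exp (w i * z) - 1)"
  let ?F = "\<lambda>z. exp (x * z) * (\<Prod>i=1..d. ?g i z)"
  have "?F has_fps_expansion bernoulli_fps d w x"
    unfolding bernoulli_fps_def
    by (intro fps_expansion_intros bernoulli_factor_expansion assms)
  moreover have "?F holomorphic_on eball 0 (ereal r)"
    unfolding eball_ereal
    by (intro holomorphic_intros bernoulli_factor_holomorphic assms r)
  ultimately have "(\<lambda>n. fps_nth (bernoulli_fps d w x) n * z ^ n) sums ?F z"
    using r(1) by (intro has_fps_expansion_imp_sums_complex[where r = "ereal r"]) auto
  moreover have "?F z = z ^ d * exp (x * z) * (\<Prod>i=1..d. w i / (exp (w i * z) - 1))"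
  proof -
    have "(\<Prod>i=1..d. ?g i z) = (\<Prod>i=1..d. z * (w i / (exp (w i * z) - 1)))"
      using assms(2) by (intro prod.cong) auto
    also have "\<dots> = z ^ d * (\<Prod>i=1..d. w i / (exp (w i * z) - 1))"
      by (subst prod.distrib) simp
    finally show ?thesis
      by simp
  qed
  ultimately show ?thesis
    by (simp add: bernoulli_poly_def mult_ac)
qed

end

theory Submission
  imports Defs
begin

text \<open>
  For \<open>Re s > d\<close>, expanding the geometric series gives
  \<open>\<Gamma>(s) \<zeta>(s) = \<integral> t powr (s - 1) * K(t) dt\<close> with \<open>K(t) = 1 / \<Prod>\<^sub>i (1 - exp (- w\<^sub>i t)) - 1\<close>.
  Let \<open>a\<^sub>k\<close> be the Taylor coefficients of \<open>t ^ d * exp t * K(t)\<close>. Subtracting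
  \<open>t powr (-d) * exp (-t) * (\<Sum>k<N. a\<^sub>k t ^ k)\<close> from \<open>K\<close> leaves a remainder of order \<open>t powr (N - d)\<close> at \<open>0\<close>,
  whose Mellin transform is holomorphic on \<open>Re s > d - N\<close>, while the subtracted terms contribute
  \<open>a\<^sub>k \<Gamma>(s - d + k)\<close>. These expressions agree on the common half-planes and so define the continuation.

  For \<open>N = d - q + 1\<close> the remainder is the integrand of \<open>J\<close>, and \<open>\<Gamma>(s - m) / \<Gamma>(s) = \<Prod>\<^sub>j\<^sub>\<le>\<^sub>m 1 / (s - j)\<close> has at
  \<open>s = q \<le> m\<close> a simple pole with finite part
  \<open>(-1) ^ (m - q) * (H\<^bsub>m-q\<^esub> - H\<^bsub>q-1\<^esub>) / ((q - 1)! * (m - q)!)\<close>. The values \<open>B\<^sub>k(-1|w)\<close> are turned into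
  \<open>B\<^sub>k(w)\<close> by multiplying generating functions with \<open>exp z\<close>.
\<close>

section \<open>Holomorphic parameter integrals\<close>

text \<open>A local integrable majorant of the integrand itself suffices: Cauchy's inequality turns
  it into the bound \<open>B x / r\<close> for the derivatives in the parameter, the mean value
  inequality passes this on to the difference quotients, and dominated convergence along sequences
  differentiates under the integral.\<close>

lemma holomorphic_on_integral_dominated:
  fixes f :: "complex \<Rightarrow> 'a \<Rightarrow> complex"
  assumes U: "open U"
    and meas: "\<And>s. s \<in> U \<Longrightarrow> f s \<in> borel_measurable M"
    and hol: "\<And>x. x \<in> space M \<Longrightarrow> (\<lambda>s. f s x) holomorphic_on U"
    and dom: "\<And>s. s \<in> U \<Longrightarrow> \<exists>r>0. \<exists>B. integrable M B \<and>
                (\<forall>z\<in>ball s r. \<forall>x\<in>space M. norm (f z x) \<le> B x)"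
  shows "(\<lambda>s. \<integral>x. f s x \<partial>M) holomorphic_on U"
proof -
  have "(\<lambda>s. \<integral>x. f s x \<partial>M) field_differentiable at s" if s: "s \<in> U" for s
  proof -
    obtain r1 B where r1: "r1 > 0" "integrable M B"
      "\<And>z x. z \<in> ball s r1 \<Longrightarrow> x \<in> space M \<Longrightarrow> norm (f z x) \<le> B x"
      using dom[OF s] by blast
    obtain r2 where r2: "r2 > 0" "ball s r2 \<subseteq> U"
      using U s by (meson openE)
    \<comment> \<open>A disc of radius \<open>r\<close> around a point of \<open>cball s r\<close>
      stays within distance \<open>2 * r\<close> of \<open>s\<close>, so a third of both radii keeps
      it inside \<open>ball s r1\<close> and \<open>U\<close>.\<close>
    define r where "r = min r1 r2 / 3"
    have r: "r > 0" "3 * r \<le> r1" "3 * r \<le> r2"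
      using r1(1) r2(1) by (auto simp: r_def)
    define D where "D = (\<lambda>x. deriv (\<lambda>s. f s x) s)"
    have deriv: "((\<lambda>z. f z x) has_field_derivative deriv (\<lambda>z. f z x) u) (at u)"
      if "x \<in> space M" "u \<in> U" for x u
      using hol[OF that(1)] U that(2) by (rule holomorphic_derivI)
    have dbound: "norm (deriv (\<lambda>z. f z x) u) \<le> B x / r"
      if x: "x \<in> space M" and u: "u \<in> cball s r" for x u
    proof -
      have sub: "cball u r \<subseteq> ball s r1" "cball u r \<subseteq> U"
      proof -
        have "dist s y < 3 * r" if "y \<in> cball u r" for y
          using that u r dist_triangle[of s y u] by auto
        then show "cball u r \<subseteq> ball s r1" "cball u r \<subseteq> U"
          using r r2(2) by (auto simp: subset_iff) (meson less_le_trans mem_ball)+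
      qed
      have "norm ((deriv ^^ 1) (\<lambda>z. f z x) u) \<le> fact 1 * B x / r ^ 1"
      proof (rule Cauchy_inequality)
        show "(\<lambda>z. f z x) holomorphic_on ball u r"
          using hol[OF x] sub(2) by (meson ball_subset_cball holomorphic_on_subset)
        show "continuous_on (cball u r) (\<lambda>z. f z x)"
          using hol[OF x] sub(2) by (meson holomorphic_on_imp_continuous_on holomorphic_on_subset)
        show "norm (f z x) \<le> B x" if "norm (u - z) = r" for z
          using that sub(1) x by (intro r1(3)) (auto simp: dist_norm)
      qed (use r in auto)
      then show ?thesis by simp
    qed
    have quot: "norm ((f z x - f s x) / (z - s)) \<le> B x / r"
      if x: "x \<in> space M" and z: "z \<in> cball s r" "z \<noteq> s" for x z
    proof -
      have "norm (f z x - f s x) \<le> B x / r * norm (z - s)"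
      proof (rule field_differentiable_bound)
        show "convex (cball s r)" by simp
        show "((\<lambda>z. f z x) has_field_derivative deriv (\<lambda>z. f z x) u) (at u within cball s r)"
          if "u \<in> cball s r" for u
        proof (rule has_field_derivative_at_within, rule deriv[OF x])
          show "u \<in> U" using that r r2(2) by (auto simp: subset_iff)
        qed
        show "norm (deriv (\<lambda>z. f z x) u) \<le> B x / r" if "u \<in> cball s r" for u
          using dbound[OF x that] .
      qed (use z r in auto)
      then show ?thesis using z by (simp add: norm_divide field_simps)
    qed
    have lim: "(\<lambda>n. ((\<integral>x. f (X n) x \<partial>M) - (\<integral>x. f s x \<partial>M)) / (X n - s)) \<longlonglongrightarrow> (\<integral>x. D x \<partial>M)"
      if X: "\<And>n. X n \<in> cball s r" "\<And>n. X n \<noteq> s" "X \<longlonglongrightarrow> s" for X :: "nat \<Rightarrow> complex"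
    proof -
      have int: "integrable M (f z)" if "z \<in> cball s r" for z
      proof (rule Bochner_Integration.integrable_bound)
        show "integrable M B" by fact
        show "f z \<in> borel_measurable M"
          using that r r2 by (intro meas) (auto simp: subset_iff)
        show "AE x in M. norm (f z x) \<le> norm (B x)"
          using that r r1(3)[of z] by (intro AE_I2) (force simp: abs_if)
      qed
      have tend: "(\<lambda>n. (f (X n) x - f s x) / (X n - s)) \<longlonglongrightarrow> D x" if x: "x \<in> space M" for x
      proof -
        have "((\<lambda>z. (f z x - f s x) / (z - s)) \<longlongrightarrow> D x) (at s)"
          using deriv[OF x s] by (simp add: D_def has_field_derivative_iff)
        then show ?thesis
          using X by (auto simp: tendsto_at_iff_sequentially o_def)
      qed
      have "(\<lambda>n. \<integral>x. (f (X n) x - f s x) / (X n - s) \<partial>M) \<longlonglongrightarrow> (\<integral>x. D x \<partial>M)"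
      proof (rule integral_dominated_convergence)
        show meas': "(\<lambda>x. (f (X n) x - f s x) / (X n - s)) \<in> borel_measurable M" for n
          using int[OF X(1)] int[of s] r by (auto intro!: borel_measurable_divide borel_measurable_diff)
        show "D \<in> borel_measurable M"
          using tend meas' by (rule borel_measurable_LIMSEQ_metric[rotated])
        show "integrable M (\<lambda>x. B x / r)" using r1 by simp
        show "AE x in M. (\<lambda>n. (f (X n) x - f s x) / (X n - s)) \<longlonglongrightarrow> D x"
          using tend by simp
        show "AE x in M. norm ((f (X n) x - f s x) / (X n - s)) \<le> B x / r" for n
          using quot X by (intro AE_I2) auto
      qed
      also have "(\<lambda>n. \<integral>x. (f (X n) x - f s x) / (X n - s) \<partial>M) =
                 (\<lambda>n. ((\<integral>x. f (X n) x \<partial>M) - (\<integral>x. f s x \<partial>M)) / (X n - s))"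
        using int[OF X(1)] int[of s] r by simp
      finally show ?thesis .
    qed
    have "((\<lambda>z. ((\<integral>x. f z x \<partial>M) - (\<integral>x. f s x \<partial>M)) / (z - s)) \<longlongrightarrow> (\<integral>x. D x \<partial>M)) (at s within cball s r)"
      unfolding tendsto_at_iff_sequentially using lim by (auto simp: o_def)
    then have "((\<lambda>s. \<integral>x. f s x \<partial>M) has_field_derivative (\<integral>x. D x \<partial>M)) (at s within cball s r)"
      by (simp add: has_field_derivative_iff)
    moreover have "at s within cball s r = at s"
      using r by (intro at_within_interior) (simp add: interior_cball)
    ultimately show ?thesis
      by (auto simp: field_differentiable_def)
  qed
  then show ?thesis
    by (simp add: holomorphic_on_def field_differentiable_at_within)
qed

section \<open>Mellin transforms\<close>

abbreviation mellin :: "(real \<Rightarrow> complex) \<Rightarrow> complex \<Rightarrow> complex" where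
  "mellin \<phi> s \<equiv> (LBINT t:{0<..}. of_real t powr (s - 1) * \<phi> t)"

lemma set_integrable_powr_exp:
  fixes a c :: real
  assumes "a > 0" "c > 0"
  shows "set_integrable lborel {0<..} (\<lambda>t. t powr (a - 1) * exp (- c * t))"
proof -
  have "(\<lambda>t. complex_of_real t powr (of_real a - 1) / of_real (exp (c * t))) absolutely_integrable_on {0<..}"
    using assms by (intro absolutely_integrable_Gamma_integral) auto
  then have "set_integrable lebesgue {0<..} (\<lambda>t. norm (complex_of_real t powr (of_real a - 1) / of_real (exp (c * t))))"
    by (rule set_integrable_norm)
  also have "?this \<longleftrightarrow> set_integrable lebesgue {0<..} (\<lambda>t. t powr (a - 1) * exp (- c * t))"
    by (intro set_integrable_cong refl)
       (auto simp: norm_divide norm_powr_real_powr exp_minus field_simps)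
  finally show ?thesis
    unfolding set_integrable_def by (subst (asm) integrable_completion) auto
qed

text \<open>One estimate on the whole half-line: \<open>p\<close> records the order at 0 and
  \<open>c\<close> the decay at infinity. It makes the Mellin transform absolutely convergent and
  holomorphic for Re s > -p.\<close>

locale mellin_bound =
  fixes \<phi> :: "real \<Rightarrow> complex" and C p c :: real
  assumes cont: "continuous_on {0<..} \<phi>"
    and c: "c > 0"
    and bound: "\<And>t. t > 0 \<Longrightarrow> norm (\<phi> t) \<le> C * t powr p * exp (- c * t)"
begin

lemma measurable: "(\<lambda>t. indicator {0<..} t *\<^sub>R (of_real t powr (s - 1) * \<phi> t)) \<in> borel_measurable borel"
  using cont by (intro borel_measurable_continuous_on_indicator continuous_intros) auto

lemma pointwise:
  assumes "t > 0"
  shows "norm (of_real t powr (s - 1) * \<phi> t) \<le> C * (t powr (Re s + p - 1) * exp (- c * t))"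
proof -
  have "norm (of_real t powr (s - 1) * \<phi> t) \<le> t powr (Re s - 1) * (C * t powr p * exp (- c * t))"
    unfolding norm_mult using assms bound by (intro mult_mono) (auto simp: norm_powr_real_powr)
  also have "\<dots> = C * ((t powr (Re s - 1) * t powr p) * exp (- c * t))"
    by (simp add: mult_ac)
  also have "t powr (Re s - 1) * t powr p = t powr (Re s + p - 1)"
    by (simp add: powr_add [symmetric] algebra_simps)
  finally show ?thesis .
qed

lemma integrable:
  assumes "Re s + p > 0"
  shows "set_integrable lborel {0<..} (\<lambda>t. of_real t powr (s - 1) * \<phi> t)"
  unfolding set_integrable_def
proof (rule Bochner_Integration.integrable_bound)
  show "Bochner_Integration.integrable lborel
          (\<lambda>t. indicator {0<..} t *\<^sub>R (C * (t powr (Re s + p - 1) * exp (- c * t))))"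
    using set_integrable_powr_exp[OF assms c] unfolding set_integrable_def[symmetric] by simp
  show "AE x in lborel. norm (indicator {0<..} x *\<^sub>R (of_real x powr (s - 1) * \<phi> x)) \<le>
          norm (indicator {0<..} x *\<^sub>R (C * (x powr (Re s + p - 1) * exp (- c * x))))"
    using pointwise[of _ s] by (intro AE_I2) (force simp: indicator_def abs_if)
qed (use measurable in auto)

lemma holomorphic: "mellin \<phi> holomorphic_on {s. Re s > - p}"
  unfolding set_lebesgue_integral_def
proof (rule holomorphic_on_integral_dominated)
  show "open {s. Re s > - p}" by (rule open_halfspace_Re_gt)
  show "(\<lambda>s. indicat_real {0<..} t *\<^sub>R (of_real t powr (s - 1) * \<phi> t)) holomorphic_on {s. Re s > - p}" for t
    by (cases "t > 0") (auto intro!: holomorphic_intros simp: indicator_def)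
  fix s assume s: "s \<in> {s. Re s > - p}"
  \<comment> \<open>Half the distance to the boundary line, so that the exponent belonging to
    \<open>Re s - r\<close> is still integrable at 0.\<close>
  define r where "r = (Re s + p) / 2"
  have r: "r > 0" using s by (simp add: r_def)
  let ?g = "\<lambda>\<sigma> t. C * (t powr (\<sigma> + p - 1) * exp (- c * t))"
  \<comment> \<open>Among the exponents that occur for \<open>z\<close> in the disc, the largest
    dominates for t at least 1 and the smallest for t below 1; the sum of both extremes dominates
    everywhere.\<close>
  let ?B = "\<lambda>t. indicator {0<..} t *\<^sub>R (?g (Re s - r) t + ?g (Re s + r) t)"
  show "\<exists>r>0. \<exists>B. Bochner_Integration.integrable lborel B \<and> (\<forall>z\<in>ball s r. \<forall>x\<in>space lborel.
          norm (indicat_real {0<..} x *\<^sub>R (of_real x powr (z - 1) * \<phi> x)) \<le> B x)"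
  proof (intro exI conjI ballI)
    show "r > 0" by fact
    have "set_integrable lborel {0<..} (\<lambda>t. ?g (Re s - r) t + ?g (Re s + r) t)"
      using s r c by (intro set_integral_add set_integrable_mult_right set_integrable_powr_exp)
         (auto simp: r_def field_simps)
    then show "Bochner_Integration.integrable lborel ?B"
      unfolding set_integrable_def .
    fix z t assume z: "z \<in> ball s r"
    have C: "C \<ge> 0"
    proof -
      have "0 \<le> norm (\<phi> 1)" by simp
      also have "\<dots> \<le> C * exp (- c)" using bound[of 1] by simp
      finally show ?thesis by (simp add: zero_le_mult_iff)
    qed
    show "norm (indicat_real {0<..} t *\<^sub>R (of_real t powr (z - 1) * \<phi> t)) \<le> ?B t"
    proof (cases "t > 0")
      case t: True
      have "\<bar>Re (z - s)\<bar> < r"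
        using z abs_Re_le_cmod[of "z - s"] by (auto simp: dist_norm norm_minus_commute)
      then have Re: "Re s - r \<le> Re z" "Re z \<le> Re s + r" by auto
      have "t powr (Re z + p - 1) \<le> t powr (Re s - r + p - 1) + t powr (Re s + r + p - 1)"
      proof (cases "t \<ge> 1")
        case True
        then have "t powr (Re z + p - 1) \<le> t powr (Re s + r + p - 1)"
          using Re by (intro powr_mono) auto
        then show ?thesis by (smt (verit) powr_ge_zero)
      next
        case False
        then have "t powr (Re z + p - 1) \<le> t powr (Re s - r + p - 1)"
          using Re t by (intro powr_mono') auto
        then show ?thesis by (smt (verit) powr_ge_zero)
      qed
      then have "C * (t powr (Re z + p - 1) * exp (- c * t)) \<le>
          C * ((t powr (Re s - r + p - 1) + t powr (Re s + r + p - 1)) * exp (- c * t))"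
        using C by (intro mult_left_mono mult_right_mono) auto
      then show ?thesis
        using pointwise[OF t, of z] t by (simp add: algebra_simps)
    qed auto
  qed
qed (use measurable in auto)

end

lemma mellin_bound_exp:
  fixes z :: complex
  assumes "Re z > 0"
  shows "mellin_bound (\<lambda>t. exp (- (z * of_real t))) 1 0 (Re z)"
  by unfold_locales (use assms in \<open>auto intro!: continuous_intros simp: norm_exp_eq_Re\<close>)

text \<open>Substitution of a t for t in Euler's integral; the Jacobian \<open>a\<close> and the
  factor \<open>a powr (s - 1)\<close> combine to \<open>a powr s\<close>.\<close>

lemma mellin_exp_real:
  assumes "Re s > 0" "a > 0"
  shows "mellin (\<lambda>t. exp (- (of_real a * of_real t))) s = Gamma s * of_real a powr (-s)"
proof -
  let ?f = "\<lambda>t. indicator {0<..} t *\<^sub>R (of_real t powr (s - 1) * exp (- of_real t)) :: complex"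
  have "set_integrable lebesgue {0<..} (\<lambda>t. complex_of_real t powr (s - 1) / of_real (exp t))"
    using absolutely_integrable_Gamma_integral'[OF assms(1)] .
  then have "(LINT t:{0<..}|lebesgue. complex_of_real t powr (s - 1) / of_real (exp t)) = Gamma s"
    using Gamma_integral_complex'[OF assms(1)]
    by (simp add: set_lebesgue_integral_eq_integral integral_unique)
  also have "(LINT t:{0<..}|lebesgue. complex_of_real t powr (s - 1) / of_real (exp t)) =
             (LINT t:{0<..}|lebesgue. complex_of_real t powr (s - 1) * exp (- of_real t))"
    by (intro set_lebesgue_integral_cong) (auto simp: exp_minus field_simps exp_of_real)
  also have "\<dots> = (\<integral>t. ?f t \<partial>lborel)"
    unfolding set_lebesgue_integral_def
    by (intro integral_completion) (auto intro!: borel_measurable_continuous_on_indicator continuous_intros)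
  also have "\<dots> = \<bar>a\<bar> *\<^sub>R (\<integral>t. ?f (0 + a * t) \<partial>lborel)"
    using assms by (intro lborel_integral_real_affine) auto
  also have "(\<lambda>t. ?f (0 + a * t)) = (\<lambda>t. of_real a powr (s - 1) *
               (indicator {0<..} t *\<^sub>R (of_real t powr (s - 1) * exp (- (of_real a * of_real t)))))"
  proof
    fix t :: real
    show "?f (0 + a * t) = of_real a powr (s - 1) *
               (indicator {0<..} t *\<^sub>R (of_real t powr (s - 1) * exp (- (of_real a * of_real t))))"
      using assms by (auto simp: indicator_def powr_times_real zero_less_mult_iff)
  qed
  also have "\<bar>a\<bar> *\<^sub>R (\<integral>t. of_real a powr (s - 1) *
               (indicator {0<..} t *\<^sub>R (of_real t powr (s - 1) * exp (- (of_real a * of_real t)))) \<partial>lborel)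
             = (of_real a * of_real a powr (s - 1)) * mellin (\<lambda>t. exp (- (of_real a * of_real t))) s"
    using assms by (simp add: set_lebesgue_integral_def scaleR_conv_of_real)
  also have "of_real a * of_real a powr (s - 1) = (of_real a powr s :: complex)"
    using assms by (simp add: powr_diff)
  finally show ?thesis
    using assms by (simp add: powr_minus field_simps)
qed

lemma mellin_exp:
  assumes s: "Re s > 0" and z: "Re z > 0"
  shows "mellin (\<lambda>t. exp (- (z * of_real t))) s = Gamma s * z powr (-s)"
proof -
  let ?S = "{z. Re z > 0}"
  let ?L = "\<lambda>z. mellin (\<lambda>t. exp (- (z * of_real t))) s"
  let ?g = "\<lambda>z. ?L z - Gamma s * z powr (-s)"
  have "?L holomorphic_on ?S"
    unfolding set_lebesgue_integral_def
  proof (rule holomorphic_on_integral_dominated)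
    show "open ?S" by (rule open_halfspace_Re_gt)
    show "(\<lambda>t. indicat_real {0<..} t *\<^sub>R (of_real t powr (s - 1) * exp (- (z * of_real t))))
            \<in> borel_measurable lborel" if "z \<in> ?S" for z
      using mellin_bound.measurable[OF mellin_bound_exp, of z s] that by simp
    show "(\<lambda>z. indicat_real {0<..} t *\<^sub>R (of_real t powr (s - 1) * exp (- (z * of_real t))))
            holomorphic_on ?S" for t
      by (intro holomorphic_intros)
    fix z assume z: "z \<in> ?S"
    \<comment> \<open>On the disc of this radius the real part stays at least \<open>r\<close>,
      which yields one exponential majorant for all its points.\<close>
    define r where "r = Re z / 2"
    have r: "r > 0" using z by (simp add: r_def)
    show "\<exists>r>0. \<exists>B. integrable lborel B \<and> (\<forall>z\<in>ball z r. \<forall>x\<in>space lborel.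
           norm (indicat_real {0<..} x *\<^sub>R (of_real x powr (s - 1) * exp (- (z * of_real x)))) \<le> B x)"
    proof (intro exI conjI ballI)
      show "r > 0" by fact
      show "integrable lborel (\<lambda>t. indicator {0<..} t *\<^sub>R (t powr (Re s - 1) * exp (- r * t)))"
        using set_integrable_powr_exp[OF s r] unfolding set_integrable_def .
      fix u t assume u: "u \<in> ball z r"
      have "\<bar>Re (u - z)\<bar> < r"
        using u abs_Re_le_cmod[of "u - z"] by (auto simp: dist_norm norm_minus_commute)
      then have "r \<le> Re u" by (simp add: r_def abs_if split: if_splits)
      then show "norm (indicat_real {0<..} t *\<^sub>R (of_real t powr (s - 1) * exp (- (u * of_real t))))
                  \<le> indicator {0<..} t *\<^sub>R (t powr (Re s - 1) * exp (- r * t))"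
        by (auto simp: indicator_def norm_mult norm_powr_real_powr intro!: mult_left_mono)
    qed
  qed
  then have hol: "?g holomorphic_on ?S"
    by (intro holomorphic_intros) (auto simp: complex_nonpos_Reals_iff)
  \<comment> \<open>no rotation of the contour: both sides are holomorphic in \<open>z\<close> and agree on the positive reals\<close>
  have "?g z = 0"
  proof (rule analytic_continuation[OF hol])
    show "open ?S" by (rule open_halfspace_Re_gt)
    show "connected ?S" by (intro convex_connected convex_halfspace_Re_gt)
    show "of_real ` {0<..} \<subseteq> ?S" by auto
    show "(1 :: complex) islimpt of_real ` {0<..}"
      unfolding islimpt_approachable
    proof (intro allI impI)
      fix e :: real assume "e > 0"
      then show "\<exists>x'\<in>complex_of_real ` {0<..}. x' \<noteq> 1 \<and> dist x' 1 < e"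
        by (intro bexI[of _ "of_real (1 + e / 2)"]) (auto simp: dist_norm complex_eq_iff)
    qed
    show "?g x = 0" if "x \<in> of_real ` {0<..}" for x
      using that mellin_exp_real[OF s] by auto
  qed (use z in auto)
  then show ?thesis by simp
qed

section \<open>The kernel of the Barnes zeta function\<close>

abbreviation nonzero_multi_indices :: "nat \<Rightarrow> (nat \<Rightarrow> nat) set" where
  "nonzero_multi_indices d \<equiv> multi_indices d - {\<lambda>i\<in>{1..d}. 0}"

definition barnes_kernel :: "nat \<Rightarrow> (nat \<Rightarrow> complex) \<Rightarrow> real \<Rightarrow> complex" where
  "barnes_kernel d w t = 1 / (\<Prod>i=1..d. 1 - exp (- (w i * of_real t))) - 1"

section \<open>Geometric series over multi-indices and decay of the kernel\<close>

lemma abs_summable_on_power: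
  fixes x :: "'a :: real_normed_div_algebra"
  assumes "norm x < 1"
  shows "(\<lambda>k. norm (x ^ k)) summable_on UNIV"
  using assms by (simp add: norm_power summable_on_UNIV_nonneg_real_iff summable_geometric)

lemma infsum_power:
  fixes x :: "'a :: {real_normed_field, banach}"
  assumes "norm x < 1"
  shows "infsum (\<lambda>k. x ^ k) UNIV = 1 / (1 - x)"
  using assms by (intro infsumI norm_summable_imp_has_sum)
     (auto simp: norm_power summable_geometric geometric_sums)

lemma multi_indices_geometric:
  fixes x :: "nat \<Rightarrow> complex"
  assumes "\<And>i. i \<in> {1..d} \<Longrightarrow> norm (x i) < 1"
  shows "(\<lambda>n. norm (\<Prod>i=1..d. x i ^ n i)) summable_on multi_indices d" (is ?sum)
    and "((\<lambda>n. \<Prod>i=1..d. x i ^ n i) has_sum 1 / (\<Prod>i=1..d. 1 - x i)) (multi_indices d)"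
proof -
  have "infsum (\<lambda>n. \<Prod>i=1..d. norm (x i) ^ n i) (multi_indices d) =
          (\<Prod>i=1..d. infsum (\<lambda>k. norm (x i) ^ k) UNIV)"
    unfolding multi_indices_def using assms
    by (intro infsum_prod_PiE_abs abs_summable_on_power) auto
  also have "\<dots> = (\<Prod>i=1..d. 1 / (1 - norm (x i)))"
    using assms by (intro prod.cong infsum_power refl) auto
  also have "\<dots> \<noteq> 0"
    using assms by (simp add: less_imp_neq)
  \<comment> \<open>a sum that does not converge has the junk value \<open>0\<close>\<close>
  finally have "(\<lambda>n. \<Prod>i=1..d. norm (x i) ^ n i) summable_on multi_indices d"
    by (meson infsum_not_exists)
  then show sum: ?sum
    by (simp add: norm_power flip: prod_norm)
  have "infsum (\<lambda>n. \<Prod>i=1..d. x i ^ n i) (multi_indices d) =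
          (\<Prod>i=1..d. infsum (\<lambda>k. x i ^ k) UNIV)"
    unfolding multi_indices_def using assms
    by (intro infsum_prod_PiE_abs abs_summable_on_power) auto
  also have "\<dots> = (\<Prod>i=1..d. 1 / (1 - x i))"
    using assms by (intro prod.cong infsum_power refl) auto
  also have "\<dots> = 1 / (\<Prod>i=1..d. 1 - x i)"
    by (simp add: prod_dividef)
  finally show "((\<lambda>n. \<Prod>i=1..d. x i ^ n i) has_sum 1 / (\<Prod>i=1..d. 1 - x i)) (multi_indices d)"
    using abs_summable_summable[OF sum] by (simp add: has_sum_iff)
qed

lemma exp_dot:
  "exp (- (dot d n w * of_real t)) = (\<Prod>i=1..d. exp (- (w i * of_real t)) ^ n i)"
  by (simp add: dot_def sum_distrib_left exp_sum sum_negf [symmetric] mult_ac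
        flip: exp_of_nat_mult)

lemma
  fixes w :: "nat \<Rightarrow> complex"
  assumes w: "\<And>i. i \<in> {1..d} \<Longrightarrow> Re (w i) > 0" and t: "t > 0"
  shows barnes_kernel_abs_summable:
      "(\<lambda>n. norm (exp (- (dot d n w * of_real t)))) summable_on nonzero_multi_indices d"
    and barnes_kernel_has_sum:
      "((\<lambda>n. exp (- (dot d n w * of_real t))) has_sum barnes_kernel d w t) (nonzero_multi_indices d)"
proof -
  have less: "norm (exp (- (w i * of_real t))) < 1" if "i \<in> {1..d}" for i
    using w[OF that] t by (simp add: norm_exp_eq_Re)
  note * = multi_indices_geometric[of d "\<lambda>i. exp (- (w i * of_real t))", OF less, folded exp_dot]
  show "(\<lambda>n. norm (exp (- (dot d n w * of_real t)))) summable_on nonzero_multi_indices d"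
    using *(1) by (rule summable_on_subset_banach) auto
  \<comment> \<open>Leaving out the zero multi-index subtracts exp 0 = 1; this is the
    \<open>- 1\<close> in \<open>barnes_kernel\<close>.\<close>
  have "((\<lambda>n. exp (- (dot d n w * of_real t))) has_sum
          (1 / (\<Prod>i=1..d. 1 - exp (- (w i * of_real t))) - exp (- (dot d (\<lambda>i\<in>{1..d}. 0) w * of_real t))))
        (nonzero_multi_indices d)"
    using *(2) by (intro has_sum_Diff) (auto simp: multi_indices_def intro!: has_sum_finiteI)
  then show "((\<lambda>n. exp (- (dot d n w * of_real t))) has_sum barnes_kernel d w t) (nonzero_multi_indices d)"
    by (simp add: barnes_kernel_def dot_def)
qed

text \<open>Some coordinate of a nonzero multi-index is at least 1, and all other terms have
  nonnegative real part. This gives a decay rate common to all exponentials of the kernel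
  series.\<close>

lemma Re_dot_ge:
  assumes c: "\<And>i. i \<in> {1..d} \<Longrightarrow> Re (w i) \<ge> c" "c \<ge> 0" and n: "n \<in> nonzero_multi_indices d"
  shows "Re (dot d n w) \<ge> c"
proof -
  have "\<exists>i\<in>{1..d}. n i \<noteq> 0"
  proof (rule ccontr)
    assume "\<not> ?thesis"
    then have "n = (\<lambda>i\<in>{1..d}. 0)"
      using n by (intro extensionalityI[of _ "{1..d}"]) (auto simp: multi_indices_def PiE_def)
    with n show False by auto
  qed
  then obtain i where i: "i \<in> {1..d}" "n i \<noteq> 0" by blast
  have "c \<le> real (n i) * Re (w i)"
    using mult_mono[of 1 "real (n i)" c "Re (w i)"] i c by auto
  also have "\<dots> \<le> (\<Sum>i=1..d. real (n i) * Re (w i))"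
    using i c by (intro member_le_sum) (auto intro!: mult_nonneg_nonneg intro: order_trans)
  finally show ?thesis by (simp add: dot_def)
qed

text \<open>In passing from 1 to t every exponential shrinks at least by the factor exp (- c (t -
  1)), uniformly in the multi-index, so the absolutely convergent series at 1 supplies the
  constant.\<close>

lemma barnes_kernel_decay:
  assumes w: "\<And>i. i \<in> {1..d} \<Longrightarrow> Re (w i) > 0"
    and c: "\<And>i. i \<in> {1..d} \<Longrightarrow> Re (w i) \<ge> c" "c \<ge> 0"
  shows "\<exists>C. \<forall>t\<ge>1. norm (barnes_kernel d w t) \<le> C * exp (- c * t)"
proof -
  let ?A = "nonzero_multi_indices d"
  define C where "C = (\<Sum>\<^sub>\<infinity>n\<in>?A. norm (exp (- (dot d n w * of_real 1))))"
  have "norm (barnes_kernel d w t) \<le> C * exp c * exp (- c * t)" if t: "t \<ge> 1" for t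
  proof -
    have t0: "t > 0" using t by simp
    have "norm (barnes_kernel d w t) = norm (\<Sum>\<^sub>\<infinity>n\<in>?A. exp (- (dot d n w * of_real t)))"
      using barnes_kernel_has_sum[of d w t, OF w t0] infsumI by metis
    also have "\<dots> \<le> (\<Sum>\<^sub>\<infinity>n\<in>?A. norm (exp (- (dot d n w * of_real t))))"
      using barnes_kernel_abs_summable[OF w t0] by (rule norm_infsum_bound)
    also have "\<dots> \<le> (\<Sum>\<^sub>\<infinity>n\<in>?A. norm (exp (- (dot d n w * of_real 1))) * exp (- c * (t - 1)))"
    proof (rule infsum_mono)
      show "(\<lambda>n. norm (exp (- (dot d n w * of_real t)))) summable_on ?A"
        by (rule barnes_kernel_abs_summable[OF w t0])
      show "(\<lambda>n. norm (exp (- (dot d n w * of_real 1))) * exp (- c * (t - 1))) summable_on ?A"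
        by (intro summable_on_cmult_left barnes_kernel_abs_summable[OF w]) auto
      fix n assume "n \<in> ?A"
      then have "c * (t - 1) \<le> Re (dot d n w) * (t - 1)"
        using Re_dot_ge[OF c] t by (intro mult_right_mono) auto
      then have "- (Re (dot d n w) * t) \<le> - Re (dot d n w) + - c * (t - 1)"
        by (simp add: algebra_simps)
      then show "norm (exp (- (dot d n w * of_real t))) \<le>
                  norm (exp (- (dot d n w * of_real 1))) * exp (- c * (t - 1))"
        by (simp add: norm_exp_eq_Re flip: exp_add)
    qed
    also have "\<dots> = C * exp (- c * (t - 1))"
      by (simp add: C_def infsum_cmult_left')
    also have "\<dots> = C * exp c * exp (- c * t)"
      by (simp add: algebra_simps flip: exp_add)
    finally show ?thesis .
  qed
  then show ?thesis by blast
qed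

text \<open>
  Taylor coefficients at \<open>0\<close> of \<open>t ^ d * exp t * barnes_kernel d w t\<close>: the generating function of
  \<open>B\<^sub>k(-1|w)\<close> is taken at \<open>z = -t\<close>, and the second summand comes from the \<open>- 1\<close> in the kernel. The latter
  does not enter below index \<open>d\<close>, which is why it is invisible in \<open>J_integrand\<close>.
\<close>

definition kernel_coeff :: "nat \<Rightarrow> (nat \<Rightarrow> complex) \<Rightarrow> nat \<Rightarrow> complex" where
  "kernel_coeff d w k = (-1) ^ k * bernoulli_poly d w k (-1) / fact k / (\<Prod>i=1..d. w i)
     - (if k < d then 0 else 1 / fact (k - d))"

text \<open>The factor \<open>exp (- of_real t)\<close> makes the subtracted polynomial part decay
  at infinity and its Mellin transform a sum of Gamma values. For \<open>N = 0\<close> nothing is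
  subtracted.\<close>

definition kernel_remainder :: "nat \<Rightarrow> (nat \<Rightarrow> complex) \<Rightarrow> nat \<Rightarrow> real \<Rightarrow> complex" where
  "kernel_remainder d w N t = barnes_kernel d w t
     - of_real t powi (- int d) * exp (- of_real t) * (\<Sum>k<N. kernel_coeff d w k * of_real t ^ k)"

lemma kernel_coeff_sums:
  assumes w: "\<And>i. i \<in> {1..d} \<Longrightarrow> Re (w i) > 0"
  shows "\<exists>r>0. \<forall>t. 0 < t \<and> t < r \<longrightarrow>
    (\<lambda>k. kernel_coeff d w k * of_real t ^ k) sums (of_real t ^ d * exp (of_real t) * barnes_kernel d w t)"
proof -
  define P where "P = (\<Prod>i=1..d. w i)"
  have nz: "w i \<noteq> 0" if "i \<in> {1..d}" for i using w[OF that] by auto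
  have P: "P \<noteq> 0" unfolding P_def using nz by auto
  \<comment> \<open>The smallest of the radii 2 pi / |w_i| of the factors; the inserted 1 keeps the
    set nonempty for every \<open>d\<close>.\<close>
  define r where "r = Min (insert 1 ((\<lambda>i. 2 * pi / norm (w i)) ` {1..d}))"
  have r0: "r > 0" unfolding r_def using nz by (subst Min_gr_iff) auto
  have r: "r \<le> 2 * pi / norm (w i)" if "i \<in> {1..d}" for i
    unfolding r_def using that by (intro Min_le) auto
  have "(\<lambda>k. kernel_coeff d w k * of_real t ^ k) sums (of_real t ^ d * exp (of_real t) * barnes_kernel d w t)"
    if t: "0 < t" "t < r" for t
  proof -
    define T where "T = complex_of_real t"
    have T: "T \<noteq> 0" "norm T = t" using t by (auto simp: T_def)
    have "(\<lambda>n. bernoulli_poly d w n (-1) * (-T) ^ n / fact n) sums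
           ((-T) ^ d * exp (-1 * (-T)) * (\<Prod>i=1..d. w i / (exp (w i * (-T)) - 1)))"
      using nz T t r by (intro bernoulli_poly_sums) (auto intro: less_le_trans)
    then have "(\<lambda>n. bernoulli_poly d w n (-1) * (-T) ^ n / fact n / P) sums
           ((-T) ^ d * exp (-1 * (-T)) * (\<Prod>i=1..d. w i / (exp (w i * (-T)) - 1)) / P)"
      by (rule sums_divide)
    also have "(\<lambda>n. bernoulli_poly d w n (-1) * (-T) ^ n / fact n / P) =
               (\<lambda>n. ((-1) ^ n * bernoulli_poly d w n (-1) / fact n / P) * T ^ n)"
      by (subst power_minus) (simp add: mult_ac)
    also have "(-T) ^ d * exp (-1 * (-T)) * (\<Prod>i=1..d. w i / (exp (w i * (-T)) - 1)) / P =
               T ^ d * exp T * (\<Prod>i=1..d. 1 / (1 - exp (- (w i * T))))"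
    proof -
      \<comment> \<open>Each factor changes sign when its denominator is reversed; the resulting
        \<open>(-1) ^ d\<close> cancels against the sign in \<open>(-T) ^ d\<close>.\<close>
      have "(\<Prod>i=1..d. w i / (exp (w i * (-T)) - 1)) = (\<Prod>i=1..d. w i * (-1) * (1 / (1 - exp (- (w i * T)))))"
        by (intro prod.cong refl) (simp add: divide_simps, simp add: algebra_simps)
      also have "\<dots> = P * (-1) ^ d * (\<Prod>i=1..d. 1 / (1 - exp (- (w i * T))))"
        by (simp only: prod.distrib P_def prod_constant card_atLeastAtMost) simp
      finally have "(\<Prod>i=1..d. w i / (exp (w i * (-T)) - 1)) / P =
                     (-1) ^ d * (\<Prod>i=1..d. 1 / (1 - exp (- (w i * T))))"
        using P by simp
      moreover have "(-T) ^ d * (-1) ^ d = T ^ d"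
        by (simp flip: power_mult_distrib)
      ultimately show ?thesis
        by (simp add: mult_ac flip: times_divide_eq_right)
    qed
    also have "(\<Prod>i=1..d. 1 / (1 - exp (- (w i * T)))) = barnes_kernel d w t + 1"
      by (simp add: barnes_kernel_def prod_dividef T_def)
    finally have 1: "(\<lambda>n. (-1) ^ n * bernoulli_poly d w n (-1) / fact n / P * T ^ n) sums
            (T ^ d * exp T * (barnes_kernel d w t + 1))" .
    \<comment> \<open>The contribution of the \<open>- 1\<close> in the kernel: the series of
      \<open>T ^ d * exp T\<close> starts at index \<open>d\<close> and is padded with zeros
      below.\<close>
    have "(\<lambda>k. T ^ d * (T ^ k /\<^sub>R fact k)) sums (T ^ d * exp T)"
      by (intro sums_mult exp_converges)
    then have "(\<lambda>k. if k + d < d then 0 else T ^ (k + d) / fact (k + d - d)) sums (T ^ d * exp T)"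
      by (simp add: scaleR_conv_of_real power_add field_simps)
    then have "(\<lambda>k. if k < d then 0 else T ^ k / fact (k - d)) sums (T ^ d * exp T)"
      by (subst (asm) sums_iff_shift) simp
    with 1 have "(\<lambda>n. (-1) ^ n * bernoulli_poly d w n (-1) / fact n / P * T ^ n -
            (if n < d then 0 else T ^ n / fact (n - d))) sums
            (T ^ d * exp T * (barnes_kernel d w t + 1) - T ^ d * exp T)"
      by (rule sums_diff)
    also have "(\<lambda>n. (-1) ^ n * bernoulli_poly d w n (-1) / fact n / P * T ^ n -
            (if n < d then 0 else T ^ n / fact (n - d))) = (\<lambda>k. kernel_coeff d w k * T ^ k)"
      by (auto simp: kernel_coeff_def P_def fun_eq_iff algebra_simps)
    finally show ?thesis by (simp add: T_def algebra_simps)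
  qed
  with r0 show ?thesis by blast
qed

section \<open>Bounds for the kernel remainder at 0 and at infinity\<close>

lemma powser_remainder_bound:
  fixes a :: "nat \<Rightarrow> complex" and f :: "real \<Rightarrow> complex"
  assumes r: "r > 0" and sums: "\<And>t. 0 < t \<Longrightarrow> t < r \<Longrightarrow> (\<lambda>k. a k * of_real t ^ k) sums f t"
  shows "\<exists>C. \<forall>t. 0 < t \<and> t \<le> r / 2 \<longrightarrow> norm (f t - (\<Sum>k<N. a k * of_real t ^ k)) \<le> C * t ^ N"
proof -
  \<comment> \<open>Convergence at \<open>3 / 4 * r\<close>, a point strictly between
    \<open>r / 2\<close> and \<open>r\<close>, gives absolute convergence up to
    \<open>r / 2\<close>.\<close>
  have summ: "summable (\<lambda>k. norm (a k * of_real t ^ k))" if "0 < t" "t \<le> r / 2" for t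
    using sums[of "3 / 4 * r"] r that
    by (intro powser_insidea[of a "of_real (3 / 4 * r)"]) (auto simp: sums_iff)
  \<comment> \<open>The tail with \<open>t ^ N\<close> divided out, taken at the right end
    \<open>r / 2\<close>, where every term is largest.\<close>
  define C where "C = (\<Sum>k. norm (a (k + N)) * (r / 2) ^ k)"
  have summC: "summable (\<lambda>k. norm (a (k + N)) * (r / 2) ^ k)"
  proof -
    have "summable (\<lambda>k. norm (a (k + N) * of_real (r / 2) ^ (k + N)))"
      using summable_ignore_initial_segment[OF summ[of "r / 2"], of N] r by simp
    then have "summable (\<lambda>k. norm (a (k + N) * of_real (r / 2) ^ (k + N)) / (r / 2) ^ N)"
      by (rule summable_divide)
    also have "(\<lambda>k. norm (a (k + N) * of_real (r / 2) ^ (k + N)) / (r / 2) ^ N) =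
               (\<lambda>k. norm (a (k + N)) * (r / 2) ^ k)"
      using r by (auto simp: fun_eq_iff norm_mult norm_power power_add simp del: of_real_divide)
    finally show ?thesis .
  qed
  have "norm (f t - (\<Sum>k<N. a k * of_real t ^ k)) \<le> C * t ^ N" if t: "0 < t" "t \<le> r / 2" for t
  proof -
    have s: "(\<lambda>k. a k * of_real t ^ k) sums f t" using sums t r by auto
    have tail: "(\<lambda>k. a (k + N) * of_real t ^ (k + N)) sums (f t - (\<Sum>k<N. a k * of_real t ^ k))"
      using s by (rule sums_split_initial_segment)
    have "norm (f t - (\<Sum>k<N. a k * of_real t ^ k)) = norm (\<Sum>k. a (k + N) * of_real t ^ (k + N))"
      using tail by (simp add: sums_iff)
    also have "\<dots> \<le> (\<Sum>k. norm (a (k + N)) * (r / 2) ^ k * t ^ N)"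
    proof (rule norm_suminf_le)
      show "summable (\<lambda>k. norm (a (k + N)) * (r / 2) ^ k * t ^ N)"
        using summC by (rule summable_mult2)
      show "norm (a (k + N) * of_real t ^ (k + N)) \<le> norm (a (k + N)) * (r / 2) ^ k * t ^ N" for k
        using t by (auto simp: norm_mult norm_power power_add mult.assoc
              intro!: mult_left_mono mult_right_mono power_mono)
    qed
    also have "\<dots> = C * t ^ N"
      unfolding C_def using summC by (rule suminf_mult2[symmetric])
    finally show ?thesis .
  qed
  then show ?thesis by blast
qed

text \<open>A single term of the exponential series is at most its sum. The bound trades a power of
  t for part of the exponential decay.\<close>

lemma power_times_exp_bound:
  fixes t e :: real
  assumes "t \<ge> 0" "e > 0"
  shows "t ^ n * exp (- e * t) \<le> fact n / e ^ n"
proof -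
  have "(e * t) ^ n /\<^sub>R fact n = (\<Sum>k\<in>{n}. (e * t) ^ k /\<^sub>R fact k)" by simp
  also have "\<dots> \<le> (\<Sum>k. (e * t) ^ k /\<^sub>R fact k)"
    using assms by (intro sum_le_suminf summable_exp_generic) auto
  also have "\<dots> = exp (e * t)" by (simp add: exp_def)
  finally show ?thesis
    using assms by (simp add: exp_minus field_simps power_mult_distrib)
qed

text \<open>Divided by the model function \<open>t powr p * exp (- c * t)\<close>, the function has
  to be bounded: near 0 and from 1 on this is assumed, in between it follows from
  compactness.\<close>

lemma mellin_bound_exists:
  fixes \<phi> :: "real \<Rightarrow> complex"
  assumes cont: "continuous_on {0<..} \<phi>" and c: "c > 0"
    and near0: "\<exists>\<delta>>0. \<exists>C. \<forall>t. 0 < t \<and> t \<le> \<delta> \<longrightarrow> norm (\<phi> t) \<le> C * t powr p"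
    and large: "\<exists>C. \<forall>t\<ge>1. norm (\<phi> t) \<le> C * t powr p * exp (- c * t)"
  shows "\<exists>C. mellin_bound \<phi> C p c"
proof -
  define \<psi> where "\<psi> = (\<lambda>t. norm (\<phi> t) * t powr (-p) * exp (c * t))"
  have bound_iff: "norm (\<phi> t) \<le> C * t powr p * exp (- c * t) \<longleftrightarrow> \<psi> t \<le> C" if "t > 0" for C t
    using that by (simp add: \<psi>_def powr_minus exp_minus field_simps)
  obtain \<delta> C1 where C1: "\<delta> > 0" "\<And>t. 0 < t \<Longrightarrow> t \<le> \<delta> \<Longrightarrow> norm (\<phi> t) \<le> C1 * t powr p"
    using near0 by blast
  obtain C2 where C2: "\<And>t. t \<ge> 1 \<Longrightarrow> \<psi> t \<le> C2"
    using large bound_iff by (metis less_le_trans zero_less_one)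
  have "continuous_on {\<delta>..1} \<psi>"
    unfolding \<psi>_def using C1(1) by (intro continuous_intros continuous_on_subset[OF cont]) auto
  then have "compact (\<psi> ` {\<delta>..1})"
    by (intro compact_continuous_image) auto
  then obtain C3 where C3: "\<And>t. t \<in> {\<delta>..1} \<Longrightarrow> \<psi> t \<le> C3"
    by (metis bounded_real compact_imp_bounded imageI abs_le_D1)
  \<comment> \<open>The bound near 0 carries no exponential; inserting it costs at most the factor
    \<open>exp (c * \<delta>)\<close>.\<close>
  have near: "\<psi> t \<le> \<bar>C1\<bar> * exp (c * \<delta>)" if t: "0 < t" "t \<le> \<delta>" for t
  proof -
    have "norm (\<phi> t) * t powr (-p) \<le> C1"
      using C1(2)[OF t] t by (simp add: powr_minus field_simps)
    then have "norm (\<phi> t) * t powr (-p) * exp (c * t) \<le> \<bar>C1\<bar> * exp (c * \<delta>)"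
      using t c by (intro mult_mono) auto
    then show ?thesis by (simp add: \<psi>_def)
  qed
  define C where "C = Max {\<bar>C1\<bar> * exp (c * \<delta>), C2, C3}"
  have "\<psi> t \<le> C" if "t > 0" for t
    using near[of t] C2[of t] C3[of t] that unfolding C_def
    by (cases "t \<le> \<delta>"; cases "t \<ge> 1") (auto simp: le_max_iff_disj)
  then have "mellin_bound \<phi> C p c"
    by unfold_locales (use cont c bound_iff in auto)
  then show ?thesis ..
qed

lemma continuous_on_kernel_remainder:
  assumes w: "\<And>i. i \<in> {1..d} \<Longrightarrow> Re (w i) > 0"
  shows "continuous_on {0<..} (kernel_remainder d w N)"
proof -
  have nz: "exp (- (w i * of_real t)) \<noteq> 1" if "i \<in> {1..d}" "t > 0" for i t
  proof -
    have "norm (exp (- (w i * of_real t))) < 1"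
      using w[OF that(1)] that(2) by (simp add: norm_exp_eq_Re)
    then show ?thesis by (metis less_irrefl norm_one)
  qed
  then show ?thesis
    unfolding kernel_remainder_def barnes_kernel_def
    by (intro continuous_intros) auto
qed

text \<open>At 0 a Taylor tail of order \<open>t ^ N\<close> is divided by \<open>t ^ d\<close>. At
  infinity everything decays at rate \<open>c0\<close>; one half of this rate absorbs a factor
  \<open>t ^ d\<close>, which leaves the power N - d and the rate \<open>c\<close>.\<close>

lemma kernel_remainder_bound:
  assumes w: "\<And>i. i \<in> {1..d} \<Longrightarrow> Re (w i) > 0"
  shows "\<exists>C c. mellin_bound (kernel_remainder d w N) C (real N - real d) c"
proof -
  \<comment> \<open>The 1 is the rate of the factor exp (- t) in the subtracted terms.\<close>
  define c0 where "c0 = Min (insert 1 ((\<lambda>i. Re (w i)) ` {1..d}))"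
  have c0: "c0 > 0" unfolding c0_def using w by (subst Min_gr_iff) auto
  have c0_le: "c0 \<le> 1" "\<And>i. i \<in> {1..d} \<Longrightarrow> c0 \<le> Re (w i)"
    unfolding c0_def by (rule Min_le; simp)+
  define c where "c = c0 / 2"
  have c: "c > 0" "c0 = 2 * c" using c0 by (simp_all add: c_def)
  have "\<exists>C. mellin_bound (kernel_remainder d w N) C (real N - real d) c"
  proof (rule mellin_bound_exists)
    show "continuous_on {0<..} (kernel_remainder d w N)"
      using w by (rule continuous_on_kernel_remainder)
    obtain r where r: "r > 0" "\<And>t. 0 < t \<Longrightarrow> t < r \<Longrightarrow>
      (\<lambda>k. kernel_coeff d w k * of_real t ^ k) sums (of_real t ^ d * exp (of_real t) * barnes_kernel d w t)"
      using kernel_coeff_sums[of d w, OF w] by blast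
    obtain C where C: "\<And>t. 0 < t \<Longrightarrow> t \<le> r / 2 \<Longrightarrow>
       norm (of_real t ^ d * exp (of_real t) * barnes_kernel d w t - (\<Sum>k<N. kernel_coeff d w k * of_real t ^ k)) \<le> C * t ^ N"
      using powser_remainder_bound[OF r] by blast
    show "\<exists>\<delta>>0. \<exists>C. \<forall>t. 0 < t \<and> t \<le> \<delta> \<longrightarrow>
            norm (kernel_remainder d w N t) \<le> C * t powr (real N - real d)"
    proof (intro exI conjI allI impI; (elim conjE)?)
      show "r / 2 > 0" using r by simp
      fix t assume t: "0 < t" "t \<le> r / 2"
      let ?e = "of_real t ^ d * exp (of_real t) * barnes_kernel d w t - (\<Sum>k<N. kernel_coeff d w k * of_real t ^ k)"
      have "kernel_remainder d w N t = exp (- of_real t) / of_real t ^ d * ?e"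
        using t by (simp add: kernel_remainder_def power_int_minus exp_minus field_simps)
      also have "norm \<dots> = exp (-t) / t ^ d * norm ?e"
        using t by (simp add: norm_mult norm_divide norm_power norm_exp_eq_Re)
      also have "\<dots> \<le> 1 / t ^ d * (C * t ^ N)"
        using t C[OF t] by (intro mult_mono divide_right_mono) auto
      also have "\<dots> = C * t powr (real N - real d)"
        using t by (simp add: powr_diff powr_realpow)
      finally show "norm (kernel_remainder d w N t) \<le> C * t powr (real N - real d)" .
    qed
    obtain C1 where C1: "\<And>t. t \<ge> 1 \<Longrightarrow> norm (barnes_kernel d w t) \<le> C1 * exp (- c0 * t)"
      using barnes_kernel_decay[of d w c0, OF w] c0_le(2) c0 by auto
    define A where "A = (\<Sum>k<N. norm (kernel_coeff d w k))"
    define K where "K = \<bar>C1\<bar> + A"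
    have A: "A \<ge> 0" by (simp add: A_def sum_nonneg)
    show "\<exists>C. \<forall>t\<ge>1. norm (kernel_remainder d w N t) \<le> C * t powr (real N - real d) * exp (- c * t)"
    proof (intro exI allI impI)
      fix t :: real assume t: "t \<ge> 1"
      let ?S = "\<Sum>k<N. kernel_coeff d w k * of_real t ^ k"
      have "norm (kernel_remainder d w N t) \<le> norm (barnes_kernel d w t) +
              norm (of_real t powi (- int d) * exp (- of_real t) * ?S)"
        unfolding kernel_remainder_def by (rule norm_triangle_ineq4)
      also have "\<dots> \<le> \<bar>C1\<bar> * (t ^ N * exp (- c0 * t)) + A * (t ^ N * exp (- c0 * t))"
      proof (rule add_mono)
        have "norm (barnes_kernel d w t) \<le> C1 * exp (- c0 * t)" by (rule C1[OF t])
        also have "\<dots> \<le> \<bar>C1\<bar> * (t ^ N * exp (- c0 * t))"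
          using t by (intro mult_mono) auto
        finally show "norm (barnes_kernel d w t) \<le> \<bar>C1\<bar> * (t ^ N * exp (- c0 * t))" .
        have "norm ?S \<le> (\<Sum>k<N. norm (kernel_coeff d w k) * t ^ N)"
          using t by (intro sum_norm_le) (auto simp: norm_mult norm_power intro!: mult_left_mono power_increasing)
        also have "\<dots> = A * t ^ N" by (simp add: A_def sum_distrib_right)
        finally have S: "norm ?S \<le> A * t ^ N" .
        have "norm (of_real t powi (- int d) * exp (- of_real t) * ?S)
               = inverse (t ^ d) * exp (- t) * norm ?S"
          using t by (simp add: norm_mult norm_power norm_exp_eq_Re power_int_minus norm_inverse)
        also have "\<dots> \<le> 1 * exp (- c0 * t) * (A * t ^ N)"
          using t c0_le(1) A S mult_right_mono[of c0 1 t]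
          by (intro mult_mono) (auto simp: field_simps intro!: mult_nonneg_nonneg)
        finally show "norm (of_real t powi (- int d) * exp (- of_real t) * ?S)
           \<le> A * (t ^ N * exp (- c0 * t))" by (simp add: mult_ac)
      qed
      also have "\<dots> = K * (t ^ N * exp (- c0 * t))" by (simp add: K_def algebra_simps)
      also have "t ^ N * exp (- c0 * t) = (t ^ d * exp (- c * t)) * (t ^ N / t ^ d * exp (- c * t))"
        using t c(2) by (simp add: mult_ac flip: exp_add)
      also have "K * \<dots> \<le> K * ((fact d / c ^ d) * (t ^ N / t ^ d * exp (- c * t)))"
        using t power_times_exp_bound[of t c d] c(1) A
        by (intro mult_left_mono mult_right_mono) (auto simp: K_def)
      also have "\<dots> = K * (fact d / c ^ d) * t powr (real N - real d) * exp (- c * t)"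
        using t by (simp add: powr_diff powr_realpow mult_ac)
      finally show "norm (kernel_remainder d w N t) \<le> K * (fact d / c ^ d) * t powr (real N - real d) * exp (- c * t)" .
    qed
  qed (use c in auto)
  then show ?thesis by blast
qed

section \<open>The Mellin representation of the Dirichlet series\<close>

lemma nonzero_multi_indices_enumeration:
  assumes "d \<ge> 1"
  shows "\<exists>e. bij_betw e (UNIV :: nat set) (nonzero_multi_indices d)"
proof -
  have "countable (multi_indices d)"
    unfolding multi_indices_def by (intro countable_PiE) auto
  moreover have "infinite (nonzero_multi_indices d)"
  proof (rule infinite_super)
    show "range (\<lambda>k. \<lambda>i\<in>{1..d}. Suc k) \<subseteq> nonzero_multi_indices d"
    proof clarify
      fix k
      have "(\<lambda>i\<in>{1..d}. Suc k) 1 \<noteq> (\<lambda>i\<in>{1..d}. 0) 1" using assms by simp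
      then have "(\<lambda>i\<in>{1..d}. Suc k) \<noteq> (\<lambda>i\<in>{1..d}. 0)" by metis
      then show "(\<lambda>i\<in>{1..d}. Suc k) \<in> nonzero_multi_indices d"
        by (simp add: multi_indices_def)
    qed
    show "infinite (range (\<lambda>k. \<lambda>i\<in>{1..d}. Suc k))"
    proof (rule range_inj_infinite, rule injI)
      fix k l assume "(\<lambda>i\<in>{1..d}. Suc k) = (\<lambda>i\<in>{1..d}. Suc l)"
      then have "(\<lambda>i\<in>{1..d}. Suc k) 1 = (\<lambda>i\<in>{1..d}. Suc l) 1" by simp
      then show "k = l" using assms by simp
    qed
  qed
  ultimately show ?thesis
    by (meson bij_betw_from_nat_into countable_Diff)
qed

text \<open>By \<open>mellin_exp\<close> every exponential of the kernel series has Mellin transform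
  \<open>Gamma s * dot d n w powr (-s)\<close>; the series is integrated term by term and divided by
  \<open>Gamma s\<close>.\<close>

lemma hom_barnes_has_sum:
  assumes d: "d \<ge> 1" and w: "\<And>i. i \<in> {1..d} \<Longrightarrow> Re (w i) > 0" and s: "Re s > real d"
  shows "((\<lambda>n. dot d n w powr (-s)) has_sum rGamma s * mellin (barnes_kernel d w) s)
           (nonzero_multi_indices d)"
proof -
  let ?A = "nonzero_multi_indices d"
  \<comment> \<open>the terms for \<open>w'\<close> are the absolute values of those for \<open>w\<close>, so its kernel is the dominating function\<close>
  define w' where "w' = (\<lambda>i. complex_of_real (Re (w i)))"
  have w': "Re (w' i) > 0" if "i \<in> {1..d}" for i using w[OF that] by (simp add: w'_def)
  have s0: "Re s > 0" using s by linarith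
  have dotpos: "Re (dot d n w) > 0" if "n \<in> ?A" for n
  proof -
    define c where "c = Min ((\<lambda>i. Re (w i)) ` {1..d})"
    have "c > 0" unfolding c_def using w d by (subst Min_gr_iff) auto
    moreover have "Re (dot d n w) \<ge> c"
    proof (rule Re_dot_ge[OF _ _ that])
      show "c \<le> Re (w i)" if "i \<in> {1..d}" for i
        unfolding c_def using that by (intro Min_le) auto
    qed (use \<open>c > 0\<close> in auto)
    ultimately show ?thesis by simp
  qed
  have Re_dot: "Re (dot d n w') = Re (dot d n w)" for n
    by (simp add: dot_def w'_def)
  \<comment> \<open>The enumeration turns the unordered sum into a series over \<open>nat\<close>,
    to which termwise integration applies.\<close>
  obtain e where e: "bij_betw e (UNIV :: nat set) ?A"
    using nonzero_multi_indices_enumeration[OF d] by blast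
  have eA: "e k \<in> ?A" for k using e by (auto simp: bij_betw_def)
  define g where "g = (\<lambda>k t. indicator {0<..} t *\<^sub>R (of_real t powr (s - 1) * exp (- (dot d (e k) w * of_real t))))"
  have g_int: "integrable lborel (g k)" for k
    using mellin_bound.integrable[OF mellin_bound_exp[OF dotpos[OF eA[of k]]], of s] s0
    by (simp add: g_def set_integrable_def)
  have g_val: "integral\<^sup>L lborel (g k) = Gamma s * dot d (e k) w powr (-s)" for k
    using mellin_exp[OF s0 dotpos[OF eA[of k]]] by (simp add: g_def set_lebesgue_integral_def)
  define H where "H = (\<lambda>t. norm (indicator {0<..} t *\<^sub>R (of_real t powr (s - 1) * barnes_kernel d w' t)))"
  \<comment> \<open>The kernel is the remainder with \<open>N = 0\<close>, of order -d at 0, so Re s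
    > d makes its Mellin integrand absolutely integrable.\<close>
  have H_int: "integrable lborel H"
  proof -
    obtain C c where "mellin_bound (kernel_remainder d w' 0) C (real 0 - real d) c"
      using kernel_remainder_bound[of d w', OF w'] by blast
    then interpret mellin_bound "kernel_remainder d w' 0" C "real 0 - real d" c .
    have "kernel_remainder d w' 0 = barnes_kernel d w'"
      by (simp add: kernel_remainder_def fun_eq_iff)
    with integrable[of s] s show ?thesis
      unfolding H_def set_integrable_def by (intro Bochner_Integration.integrable_norm) simp
  qed
  have norm_g: "norm (g k t) = indicator {0<..} t * (norm (of_real t powr (s - 1)) * norm (exp (- (dot d (e k) w' * of_real t))))" for k t
    by (simp add: g_def norm_mult norm_exp_eq_Re Re_dot)
  have sum_g: "(\<lambda>k. norm (g k t)) sums H t" for t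
  proof (cases "t > 0")
    case t: True
    \<comment> \<open>For the real parameters \<open>w'\<close> all terms are positive reals, hence
      the modulus of the kernel is the sum of the moduli.\<close>
    have real: "exp (- (dot d n w' * of_real t)) = of_real (norm (exp (- (dot d n w' * of_real t))))" for n
    proof -
      have "dot d n w' = of_real (Re (dot d n w'))"
        by (simp add: dot_def w'_def complex_eq_iff)
      then have "exp (- (dot d n w' * of_real t)) = of_real (exp (- (Re (dot d n w') * t)))"
        by (metis exp_of_real of_real_minus of_real_mult)
      then show ?thesis by simp
    qed
    have "((\<lambda>n. of_real (norm (exp (- (dot d n w' * of_real t))))) has_sum barnes_kernel d w' t) ?A"
      using barnes_kernel_has_sum[of d w' t, OF w' t] by (subst real[symmetric])
    moreover have "((\<lambda>n. of_real (norm (exp (- (dot d n w' * of_real t))))) has_sum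
                     complex_of_real (\<Sum>\<^sub>\<infinity>n\<in>?A. norm (exp (- (dot d n w' * of_real t))))) ?A"
      by (intro has_sum_of_real has_sum_infsum barnes_kernel_abs_summable w' t)
    ultimately have eq: "barnes_kernel d w' t = complex_of_real (\<Sum>\<^sub>\<infinity>n\<in>?A. norm (exp (- (dot d n w' * of_real t))))"
      using has_sum_unique by blast
    have nn: "(\<Sum>\<^sub>\<infinity>n\<in>?A. norm (exp (- (dot d n w' * of_real t)))) \<ge> 0"
      by (intro infsum_nonneg) auto
    have "((\<lambda>n. norm (exp (- (dot d n w' * of_real t)))) has_sum norm (barnes_kernel d w' t)) ?A"
      unfolding eq using nn barnes_kernel_abs_summable[of d w' t, OF w' t] by simp
    then have "((\<lambda>k. norm (exp (- (dot d (e k) w' * of_real t)))) has_sum norm (barnes_kernel d w' t)) UNIV"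
      by (subst has_sum_reindex_bij_betw[OF e])
    then have "(\<lambda>k. norm (exp (- (dot d (e k) w' * of_real t)))) sums norm (barnes_kernel d w' t)"
      by (rule has_sum_imp_sums)
    from sums_mult[OF this, of "norm (of_real t powr (s - 1))"] t show ?thesis
      by (simp add: norm_g H_def norm_mult)
  qed (simp add: norm_g H_def)
  have summ_int: "summable (\<lambda>k. \<integral>t. norm (g k t) \<partial>lborel)"
  proof (rule summableI_nonneg_bounded)
    show "(\<Sum>k<n. \<integral>t. norm (g k t) \<partial>lborel) \<le> (\<integral>t. H t \<partial>lborel)" for n
    proof -
      have "(\<Sum>k<n. \<integral>t. norm (g k t) \<partial>lborel) = (\<integral>t. (\<Sum>k<n. norm (g k t)) \<partial>lborel)"
        using g_int by (intro Bochner_Integration.integral_sum[symmetric]) auto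
      also have "\<dots> \<le> (\<integral>t. H t \<partial>lborel)"
      proof (rule integral_mono)
        show "(\<Sum>k<n. norm (g k t)) \<le> H t" for t
          using sum_g[of t] by (metis finite_lessThan norm_ge_zero sum_le_suminf sums_iff)
      qed (use g_int H_int in auto)
      finally show ?thesis .
    qed
  qed auto
  have "(\<lambda>k. integral\<^sup>L lborel (g k)) sums (\<integral>t. (\<Sum>k. g k t) \<partial>lborel)"
    using g_int sum_g summ_int by (intro sums_integral AE_I2) (auto simp: sums_iff)
  also have "(\<lambda>t. \<Sum>k. g k t) = (\<lambda>t. indicator {0<..} t *\<^sub>R (of_real t powr (s - 1) * barnes_kernel d w t))"
  proof
    fix t :: real
    show "(\<Sum>k. g k t) = indicator {0<..} t *\<^sub>R (of_real t powr (s - 1) * barnes_kernel d w t)"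
    proof (cases "t > 0")
      case t: True
      have "((\<lambda>k. exp (- (dot d (e k) w * of_real t))) has_sum barnes_kernel d w t) UNIV"
        using barnes_kernel_has_sum[of d w t, OF w t] by (subst has_sum_reindex_bij_betw[OF e])
      then have "(\<lambda>k. exp (- (dot d (e k) w * of_real t))) sums barnes_kernel d w t"
        by (rule has_sum_imp_sums)
      from sums_mult[OF this, of "of_real t powr (s - 1)"] t show ?thesis
        by (simp add: g_def sums_iff)
    qed (simp add: g_def)
  qed
  also have "(\<integral>t. indicator {0<..} t *\<^sub>R (of_real t powr (s - 1) * barnes_kernel d w t) \<partial>lborel) =
             mellin (barnes_kernel d w) s"
    by (simp add: set_lebesgue_integral_def)
  finally have sums: "(\<lambda>k. Gamma s * dot d (e k) w powr (-s)) sums mellin (barnes_kernel d w) s"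
    by (simp add: g_val)
  \<comment> \<open>The return to an unordered sum needs absolute convergence, not only convergence
    along \<open>e\<close>.\<close>
  have "summable (\<lambda>k. norm (Gamma s * dot d (e k) w powr (-s)))"
    using summ_int
  proof (rule summable_comparison_test'[where N = 0])
    show "norm (norm (Gamma s * dot d (e k) w powr (-s))) \<le> (\<integral>t. norm (g k t) \<partial>lborel)" for k
      unfolding g_val[symmetric] using integral_norm_bound[of lborel "g k"] by simp
  qed
  with sums have "((\<lambda>k. Gamma s * dot d (e k) w powr (-s)) has_sum mellin (barnes_kernel d w) s) UNIV"
    by (intro norm_summable_imp_has_sum)
  then have "((\<lambda>k. rGamma s * (Gamma s * dot d (e k) w powr (-s))) has_sum
               rGamma s * mellin (barnes_kernel d w) s) UNIV"
    by (rule has_sum_cmult_right)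
  also have "(\<lambda>k. rGamma s * (Gamma s * dot d (e k) w powr (-s))) = (\<lambda>k. dot d (e k) w powr (-s))"
  proof -
    have "Gamma s \<noteq> 0" using s0 by (subst Gamma_eq_zero_iff) (auto elim!: nonpos_Ints_cases)
    then show ?thesis by (simp add: rGamma_inverse_Gamma fun_eq_iff field_simps)
  qed
  finally show ?thesis
    by (subst (asm) has_sum_reindex_bij_betw[OF e, of "\<lambda>n. dot d n w powr (-s)"])
qed

section \<open>Meromorphic continuation\<close>

text \<open>The uniqueness behind \<open>hom_barnes_zeta\<close>. By the identity theorem the
  difference vanishes on a punctured neighbourhood of every point, and there the convention for
  limits and poles fixes the value at the point itself.\<close>

lemma nicely_meromorphic_on_UNIV_eqI:
  assumes f: "f nicely_meromorphic_on UNIV" and g: "g nicely_meromorphic_on UNIV"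
    and U: "open U" "U \<noteq> {}" "\<And>z. z \<in> U \<Longrightarrow> f z = g z"
  shows "f = g"
proof
  fix z
  define h where "h = remove_sings (\<lambda>z. f z - g z)"
  have mero: "(\<lambda>z. f z - g z) meromorphic_on UNIV"
    using f g by (intro meromorphic_intros) (auto simp: nicely_meromorphic_on_def)
  have nice: "h nicely_meromorphic_on UNIV"
    unfolding h_def using mero by (rule remove_sings_nicely_meromorphic)
  have ev: "\<forall>\<^sub>F u in at v. h u = f u - g u" for v
    unfolding h_def using mero
    by (intro eventually_remove_sings_eq_at meromorphic_on_isolated_singularity)
       (auto intro: meromorphic_on_subset)
  obtain u where u: "u \<in> U" using U by blast
  have "\<forall>\<^sub>F v in at u. v \<in> U"
    using U u by (intro eventually_at_in_open') auto
  with ev[of u] have "\<forall>\<^sub>F v in at u. h v = 0"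
    by eventually_elim (use U in auto)
  then have "\<exists>\<^sub>F v in at u. h v = 0"
    by (intro eventually_frequently) auto
  from frequently_eq_meromorphic_imp_constant[OF this nice]
  have h0: "h v = 0" for v
    by (simp add: connected_UNIV)
  have eq: "\<forall>\<^sub>F v in at z. f v = g v"
    using ev[of z] by eventually_elim (use h0 in auto)
  have nf: "is_pole f z \<and> f z = 0 \<or> f \<midarrow>z\<rightarrow> f z" and ng: "is_pole g z \<and> g z = 0 \<or> g \<midarrow>z\<rightarrow> g z"
    using f g by (auto simp: nicely_meromorphic_on_def)
  have pole: "is_pole f z \<longleftrightarrow> is_pole g z"
    using eq by (intro is_pole_cong) auto
  have lim: "f \<midarrow>z\<rightarrow> c \<longleftrightarrow> g \<midarrow>z\<rightarrow> c" for c
    using eq by (rule tendsto_cong)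
  show "f z = g z"
  proof (cases "is_pole f z")
    case True
    \<comment> \<open>A pole excludes a finite limit, so both functions take the default value
      0.\<close>
    then have "\<not> f \<midarrow>z\<rightarrow> c" "\<not> g \<midarrow>z\<rightarrow> c" for c
      using lim by (auto simp: is_pole_def dest: not_tendsto_and_filterlim_at_infinity[rotated 2])
    with nf ng show ?thesis by auto
  next
    case False
    with nf ng pole have "f \<midarrow>z\<rightarrow> f z" "f \<midarrow>z\<rightarrow> g z" by (auto simp: lim)
    then show ?thesis by (rule LIM_unique)
  qed
qed

definition continuation_piece :: "nat \<Rightarrow> (nat \<Rightarrow> complex) \<Rightarrow> nat \<Rightarrow> complex \<Rightarrow> complex" where
  "continuation_piece d w N s = rGamma s *
     (mellin (kernel_remainder d w N) s + (\<Sum>k<N. kernel_coeff d w k * Gamma (s - of_nat d + of_nat k)))"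

text \<open>Consecutive remainders differ by the single term a_N t^(N-d) exp (- t), whose Mellin
  transform is Euler's integral; in this half-plane all the integrals converge.\<close>

lemma mellin_kernel_remainder_Suc:
  assumes w: "\<And>i. i \<in> {1..d} \<Longrightarrow> Re (w i) > 0" and s: "Re s > real d - real N"
  shows "mellin (kernel_remainder d w N) s =
           mellin (kernel_remainder d w (Suc N)) s + kernel_coeff d w N * Gamma (s - of_nat d + of_nat N)"
proof -
  let ?s = "s - of_nat d + of_nat N"
  \<comment> \<open>The factor 1 keeps the shape of \<open>mellin_bound_exp\<close> and
    \<open>mellin_exp\<close> at the parameter 1.\<close>
  let ?h = "\<lambda>t. of_real t powr (?s - 1) * exp (- (1 * complex_of_real t))"
  have s': "Re ?s > 0" using s by simp
  obtain C c where "mellin_bound (kernel_remainder d w (Suc N)) C (real (Suc N) - real d) c"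
    using kernel_remainder_bound[of d w, OF w] by blast
  then have int1: "set_integrable lborel {0<..} (\<lambda>t. of_real t powr (s - 1) * kernel_remainder d w (Suc N) t)"
    using s by (elim mellin_bound.integrable) simp
  have int2: "set_integrable lborel {0<..} ?h"
    by (rule mellin_bound.integrable[OF mellin_bound_exp]) (use s' in auto)
  have "mellin (kernel_remainder d w N) s =
        (LBINT t:{0<..}. of_real t powr (s - 1) * kernel_remainder d w (Suc N) t + kernel_coeff d w N * ?h t)"
  proof (intro set_lebesgue_integral_cong allI impI)
    fix t :: real assume "t \<in> {0<..}"
    then have t: "t > 0" by simp
    have "of_real t powr (?s - 1) = of_real t powr (s - 1) * complex_of_real t powr (of_nat N - of_nat d)"
      using t by (simp add: powr_add [symmetric] algebra_simps)
    also have "complex_of_real t powr (of_nat N - of_nat d) = of_real t ^ N * of_real t powi (- int d)"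
      using t by (simp add: powr_diff powr_nat power_int_minus field_simps)
    finally show "of_real t powr (s - 1) * kernel_remainder d w N t =
       of_real t powr (s - 1) * kernel_remainder d w (Suc N) t + kernel_coeff d w N * ?h t"
      by (simp add: kernel_remainder_def algebra_simps)
  qed simp
  also have "\<dots> = mellin (kernel_remainder d w (Suc N)) s + kernel_coeff d w N * Gamma ?s"
    using int1 int2 mellin_exp[OF s', of 1] by simp
  finally show ?thesis .
qed

text \<open>Telescoping. The Gamma terms with index below \<open>N\<close> occur in both pieces, so
  the equality holds even where these take default values.\<close>

lemma continuation_piece_mono:
  assumes w: "\<And>i. i \<in> {1..d} \<Longrightarrow> Re (w i) > 0" and s: "Re s > real d - real N" and "N \<le> M"
  shows "continuation_piece d w M s = continuation_piece d w N s"
  using \<open>N \<le> M\<close>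
proof (induction M rule: dec_induct)
  case (step M)
  have "mellin (kernel_remainder d w M) s =
          mellin (kernel_remainder d w (Suc M)) s + kernel_coeff d w M * Gamma (s - of_nat d + of_nat M)"
    using step s by (intro mellin_kernel_remainder_Suc w) auto
  then have "continuation_piece d w (Suc M) s = continuation_piece d w M s"
    by (simp add: continuation_piece_def)
  with step show ?case by simp
qed simp

text \<open>The index depends on the point and is just large enough for \<open>s\<close> to lie in
  the half-plane of the piece; by \<open>continuation_eq_piece\<close> every other admissible index
  gives the same value.\<close>

definition continuation :: "nat \<Rightarrow> (nat \<Rightarrow> complex) \<Rightarrow> complex \<Rightarrow> complex" where
  "continuation d w s = continuation_piece d w (nat \<lceil>real d - Re s\<rceil> + 1) s"

lemma continuation_eq_piece:
  assumes w: "\<And>i. i \<in> {1..d} \<Longrightarrow> Re (w i) > 0" and s: "Re s > real d - real N"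
  shows "continuation d w s = continuation_piece d w N s"
proof -
  let ?M = "nat \<lceil>real d - Re s\<rceil> + 1"
  have M: "Re s > real d - real ?M" by linarith
  show ?thesis
    unfolding continuation_def
    using continuation_piece_mono[of d w N s ?M, OF w s] continuation_piece_mono[of d w ?M s N, OF w M]
    by (cases "N \<le> ?M") auto
qed

lemma holomorphic_mellin_kernel_remainder:
  assumes w: "\<And>i. i \<in> {1..d} \<Longrightarrow> Re (w i) > 0"
  shows "mellin (kernel_remainder d w N) holomorphic_on {s. Re s > real d - real N}"
proof -
  obtain C c where "mellin_bound (kernel_remainder d w N) C (real N - real d) c"
    using kernel_remainder_bound[of d w, OF w] by blast
  from mellin_bound.holomorphic[OF this] show ?thesis by simp
qed

lemma analytic_mellin_kernel_remainder:
  assumes w: "\<And>i. i \<in> {1..d} \<Longrightarrow> Re (w i) > 0" and s: "Re s > real d - real N"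
  shows "mellin (kernel_remainder d w N) analytic_on {s}"
  using holomorphic_mellin_kernel_remainder[of d w N, OF w] s
  by (intro analytic_at[THEN iffD2] exI conjI) (auto simp: open_halfspace_Re_gt)

lemma continuation_meromorphic:
  assumes w: "\<And>i. i \<in> {1..d} \<Longrightarrow> Re (w i) > 0"
  shows "continuation d w meromorphic_on UNIV"
proof (subst meromorphic_on_meromorphic_at, intro ballI)
  fix z :: complex
  define N where "N = nat \<lceil>real d - Re z\<rceil> + 1"
  have N: "Re z > real d - real N" unfolding N_def by linarith
  have "\<forall>\<^sub>F s in at z. s \<in> {s. Re s > real d - real N}"
    using N by (intro eventually_at_in_open' open_halfspace_Re_gt) auto
  then have "\<forall>\<^sub>F s in at z. continuation d w s = continuation_piece d w N s"
    by eventually_elim (use continuation_eq_piece[of d w, OF w] in auto)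
  then have "continuation d w meromorphic_on {z} \<longleftrightarrow> continuation_piece d w N meromorphic_on {z}"
    by (intro meromorphic_on_cong) auto
  \<comment> \<open>\<open>Gamma\<close> is unfolded to the inverse of the entire function
    \<open>rGamma\<close>, so only analytic functions and inverses of such remain.\<close>
  also have "continuation_piece d w N meromorphic_on {z}"
    unfolding continuation_piece_def Gamma_def
    by (intro meromorphic_intros analytic_on_imp_meromorphic_on analytic_mellin_kernel_remainder w N
          analytic_intros)
  finally show "continuation d w meromorphic_on {z}" .
qed

text \<open>Here the piece with \<open>N = 0\<close> applies; it is analytic, so
  \<open>remove_sings\<close> leaves the value unchanged.\<close>

lemma continuation_eq_series:
  assumes d: "d \<ge> 1" and w: "\<And>i. i \<in> {1..d} \<Longrightarrow> Re (w i) > 0" and s: "Re s > real d"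
  shows "remove_sings (continuation d w) s = hom_barnes_series d w s"
proof -
  have eq: "continuation d w u = rGamma u * mellin (kernel_remainder d w 0) u" if "Re u > real d" for u
    using continuation_eq_piece[of d w 0 u, OF w] that by (simp add: continuation_piece_def)
  have "\<forall>\<^sub>F u in nhds s. u \<in> {u. Re u > real d}"
    using s by (intro eventually_nhds_in_open open_halfspace_Re_gt) auto
  then have "\<forall>\<^sub>F u in nhds s. continuation d w u = rGamma u * mellin (kernel_remainder d w 0) u"
    by eventually_elim (use eq in auto)
  then have "continuation d w analytic_on {s} \<longleftrightarrow> (\<lambda>u. rGamma u * mellin (kernel_remainder d w 0) u) analytic_on {s}"
    by (intro analytic_at_cong) auto
  also have "(\<lambda>u. rGamma u * mellin (kernel_remainder d w 0) u) analytic_on {s}"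
    using s by (intro analytic_intros analytic_mellin_kernel_remainder w) auto
  finally have "remove_sings (continuation d w) s = continuation d w s"
    by simp
  also have "\<dots> = rGamma s * mellin (barnes_kernel d w) s"
    using s by (simp add: eq kernel_remainder_def)
  also have "\<dots> = hom_barnes_series d w s"
    unfolding hom_barnes_series_def using hom_barnes_has_sum[of d w s, OF d w s] by (simp add: infsumI)
  finally show ?thesis .
qed

text \<open>\<open>remove_sings\<close> is essential: at an integer the default values of the Gamma
  terms can make \<open>continuation\<close> differ from the limit or from the value required at a
  pole.\<close>

lemma hom_barnes_zeta_eq:
  assumes d: "d \<ge> 1" and w: "\<And>i. i \<in> {1..d} \<Longrightarrow> Re (w i) > 0"
  shows "hom_barnes_zeta d w = remove_sings (continuation d w)"
  unfolding hom_barnes_zeta_def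
proof (rule the_equality)
  let ?P = "\<lambda>f. f nicely_meromorphic_on UNIV \<and> (\<forall>\<alpha>. Re \<alpha> > real d \<longrightarrow> f \<alpha> = hom_barnes_series d w \<alpha>)"
  show P: "?P (remove_sings (continuation d w))"
    using continuation_meromorphic[of d w, OF w] continuation_eq_series[of d w, OF d w]
    by (auto intro: remove_sings_nicely_meromorphic)
  fix f assume f: "?P f"
  show "f = remove_sings (continuation d w)"
  proof (rule nicely_meromorphic_on_UNIV_eqI)
    show "open {s. Re s > real d}" by (rule open_halfspace_Re_gt)
    have "of_real (real d + 1) \<in> {s. Re s > real d}" by simp
    then show "{s. Re s > real d} \<noteq> {}" by blast
  qed (use P f in auto)
qed

section \<open>The finite part\<close>

text \<open>Division by s - z shifts the Taylor series of \<open>g\<close> by one place, so its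
  linear coefficient becomes the constant term.\<close>

lemma finite_part_simple_pole:
  assumes f: "f analytic_on {z}" and g: "g analytic_on {z}" and g': "(g has_field_derivative g') (at z)"
    and eq: "\<forall>\<^sub>F s in at z. h s = f s + g s / (s - z)"
  shows "finite_part h z = f z + g'"
proof -
  let ?F = "fps_to_fls (fps_expansion f z)" and ?G = "fps_to_fls (fps_expansion g z)"
  have F: "(\<lambda>x. f (z + x)) has_laurent_expansion ?F" and G: "(\<lambda>x. g (z + x)) has_laurent_expansion ?G"
    using analytic_at_imp_has_fps_expansion[OF f] analytic_at_imp_has_fps_expansion[OF g]
    by (auto intro: has_laurent_expansion_fps)
  have "(\<lambda>x. f (z + x) + g (z + x) * x powi (- 1)) has_laurent_expansion ?F + fls_shift 1 ?G"
    by (intro has_laurent_expansion_add has_laurent_expansion_shift' F G)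
  also have "(\<lambda>x. f (z + x) + g (z + x) * x powi (- 1)) = (\<lambda>x. f (z + x) + g (z + x) / (z + x - z))"
    by (simp add: power_int_minus divide_inverse)
  finally have "laurent_expansion (\<lambda>s. f s + g s / (s - z)) z = ?F + fls_shift 1 ?G"
    by (rule laurent_expansion_eqI)
  also have "laurent_expansion (\<lambda>s. f s + g s / (s - z)) z = laurent_expansion h z"
    using eq by (intro laurent_expansion_cong) (auto elim: eventually_mono)
  finally show ?thesis
    using DERIV_imp_deriv[OF g'] by (simp add: finite_part_def fps_expansion_def)
qed

text \<open>Also true at the poles, where both sides are the junk value \<open>0\<close>.\<close>

lemma Gamma_mult_rGamma_shift:
  fixes s :: complex
  assumes "Re s > 0"
  shows "Gamma (s - of_nat m) * rGamma s = (\<Prod>j=1..m. 1 / (s - of_nat j))"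
proof -
  have nz: "rGamma s \<noteq> 0"
    using assms by (auto simp: rGamma_eq_zero_iff elim!: nonpos_Ints_cases)
  have "pochhammer (s - of_nat m) m = (\<Prod>j=1..m. s - of_nat j)"
    unfolding pochhammer_prod_rev by (intro prod.cong) (auto simp: of_nat_diff)
  moreover have "rGamma (s - of_nat m) = pochhammer (s - of_nat m) m * rGamma s"
    using pochhammer_rGamma[of "s - of_nat m" m] by simp
  ultimately show ?thesis
    using nz by (simp add: Gamma_def prod_dividef) (simp add: divide_inverse)
qed

text \<open>Logarithmic differentiation: each factor contributes -1 / (z - c_j).\<close>

lemma has_field_derivative_prod_inverse_linear:
  fixes c :: "'b \<Rightarrow> 'a :: real_normed_field"
  assumes "finite A" "\<And>j. j \<in> A \<Longrightarrow> z \<noteq> c j"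
  shows "((\<lambda>s. \<Prod>j\<in>A. 1 / (s - c j)) has_field_derivative
           - (\<Prod>j\<in>A. 1 / (z - c j)) * (\<Sum>j\<in>A. 1 / (z - c j))) (at z)"
  using assms
proof (induction A rule: finite_induct)
  case (insert a A)
  have "((\<lambda>s. 1 / (s - c a) * (\<Prod>j\<in>A. 1 / (s - c j))) has_field_derivative
      (- 1 / (z - c a) ^ 2) * (\<Prod>j\<in>A. 1 / (z - c j)) +
      1 / (z - c a) * (- (\<Prod>j\<in>A. 1 / (z - c j)) * (\<Sum>j\<in>A. 1 / (z - c j)))) (at z)"
  proof -
    have "((\<lambda>s. 1 / (s - c a)) has_field_derivative (- 1 / (z - c a) ^ 2)) (at z)"
      using insert.prems by (auto intro!: derivative_eq_intros simp: power2_eq_square)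
    from DERIV_mult[OF this insert.IH] insert.prems show ?thesis
      by (simp add: mult.commute add.commute)
  qed
  also have "(- 1 / (z - c a) ^ 2) * (\<Prod>j\<in>A. 1 / (z - c j)) +
      1 / (z - c a) * (- (\<Prod>j\<in>A. 1 / (z - c j)) * (\<Sum>j\<in>A. 1 / (z - c j))) =
      - (1 / (z - c a) * (\<Prod>j\<in>A. 1 / (z - c j))) * (1 / (z - c a) + (\<Sum>j\<in>A. 1 / (z - c j)))"
    by (simp add: power2_eq_square algebra_simps)
  finally show ?case using insert by simp
qed simp

lemma punctured_interval_split:
  assumes "1 \<le> q" "q \<le> (m::nat)"
  shows "{1..m} - {q} = (\<lambda>j. q - j) ` {1..q-1} \<union> (\<lambda>j. q + j) ` {1..m-q}"
proof
  show "{1..m} - {q} \<subseteq> (\<lambda>j. q - j) ` {1..q-1} \<union> (\<lambda>j. q + j) ` {1..m-q}"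
  proof
    fix x assume x: "x \<in> {1..m} - {q}"
    show "x \<in> (\<lambda>j. q - j) ` {1..q-1} \<union> (\<lambda>j. q + j) ` {1..m-q}"
    proof (cases "x < q")
      case True
      then show ?thesis using x by (intro UnI1 image_eqI[of _ _ "q - x"]) auto
    next
      case False
      then show ?thesis using x by (intro UnI2 image_eqI[of _ _ "x - q"]) auto
    qed
  qed
qed (use assms in auto)

text \<open>Below q the differences q - j run through 1, ..., q - 1, above q through -1, ..., -(m -
  q). This produces the two factorials, the sign and the two harmonic numbers.\<close>

lemma
  fixes q m :: nat
  assumes q: "1 \<le> q" "q \<le> m"
  shows prod_punctured: "(\<Prod>j\<in>{1..m}-{q}. 1 / (of_nat q - of_nat j)) =
           ((-1) ^ (m - q) / (fact (q - 1) * fact (m - q)) :: 'a :: field_char_0)"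
    and sum_punctured: "(\<Sum>j\<in>{1..m}-{q}. 1 / (of_nat q - of_nat j)) =
           (harm (q - 1) - harm (m - q) :: 'b :: real_normed_field)"
proof -
  have inj: "inj_on (\<lambda>j. q - j) {1..q-1}" "inj_on (\<lambda>j. q + j) {1..m-q}"
    by (auto simp: inj_on_def)
  have fin: "finite ((\<lambda>j. q - j) ` {1..q-1})" "finite ((\<lambda>j. q + j) ` {1..m-q})"
    by simp_all
  have disj: "(\<lambda>j. q - j) ` {1..q-1} \<inter> (\<lambda>j. q + j) ` {1..m-q} = {}"
    by auto
  have "(\<Prod>j\<in>{1..m}-{q}. 1 / (of_nat q - of_nat j)) =
        (\<Prod>j=1..q-1. 1 / (of_nat q - of_nat (q - j))) * (\<Prod>j=1..m-q. 1 / (of_nat q - of_nat (q + j)) :: 'a)"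
    unfolding punctured_interval_split[OF q]
    by (simp only: prod.union_disjoint[OF fin disj] prod.reindex[OF inj(1)] prod.reindex[OF inj(2)] o_def)
  also have "(\<Prod>j=1..q-1. 1 / (of_nat q - of_nat (q - j))) = (\<Prod>j=1..q-1. 1 / of_nat j :: 'a)"
    by (intro prod.cong) (auto simp: of_nat_diff)
  also have "\<dots> = 1 / fact (q - 1)"
    by (simp add: prod_dividef fact_prod)
  also have "(\<Prod>j=1..m-q. 1 / (of_nat q - of_nat (q + j)) :: 'a) = (\<Prod>j=1..m-q. (-1) * (1 / of_nat j))"
    by (intro prod.cong) auto
  also have "\<dots> = (-1) ^ (m - q) / fact (m - q)"
    by (subst prod.distrib) (simp add: prod_dividef fact_prod)
  finally show "(\<Prod>j\<in>{1..m}-{q}. 1 / (of_nat q - of_nat j)) =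
           ((-1) ^ (m - q) / (fact (q - 1) * fact (m - q)) :: 'a)" by simp
  have "(\<Sum>j\<in>{1..m}-{q}. 1 / (of_nat q - of_nat j)) =
        (\<Sum>j=1..q-1. 1 / (of_nat q - of_nat (q - j))) + (\<Sum>j=1..m-q. 1 / (of_nat q - of_nat (q + j)) :: 'b)"
    unfolding punctured_interval_split[OF q]
    by (simp only: sum.union_disjoint[OF fin disj] sum.reindex[OF inj(1)] sum.reindex[OF inj(2)] o_def)
  also have "(\<Sum>j=1..q-1. 1 / (of_nat q - of_nat (q - j))) = (harm (q - 1) :: 'b)"
    unfolding harm_def by (intro sum.cong) (auto simp: of_nat_diff divide_inverse)
  also have "(\<Sum>j=1..m-q. 1 / (of_nat q - of_nat (q + j)) :: 'b) = - harm (m - q)"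
    unfolding harm_def sum_negf[symmetric] by (intro sum.cong) (auto simp: divide_inverse)
  finally show "(\<Sum>j\<in>{1..m}-{q}. 1 / (of_nat q - of_nat j)) = (harm (q - 1) - harm (m - q) :: 'b)" by simp
qed

section \<open>The finite part in terms of J and the values B_k(-1|w)\<close>

lemma kernel_remainder_J_integrand:
  assumes "q \<in> {1..d}" "t > 0"
  shows "of_real t powr (of_nat q - 1) * kernel_remainder d w (d - q + 1) t = J_integrand d w q t"
proof -
  have "of_real t powr (of_nat q - 1) = (of_real t :: complex) ^ (q - 1)"
    using assms powr_nat[of "of_real t" "q - 1"] by (simp add: of_nat_diff)
  \<comment> \<open>Since q is at least 1, all indices are below \<open>d\<close>, where
    \<open>kernel_coeff\<close> consists of the Bernoulli term alone.\<close>
  moreover have "(\<Sum>k<d-q+1. kernel_coeff d w k * of_real t ^ k) =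
      (\<Sum>k=0..d-q. (-1) ^ k * bernoulli_poly d w k (-1) * of_real t ^ k / fact k) / (\<Prod>i=1..d. w i)"
    unfolding sum_divide_distrib using assms
    by (intro sum.cong) (auto simp: kernel_coeff_def)
  ultimately show ?thesis
    by (simp add: J_integrand_def kernel_remainder_def barnes_kernel_def)
qed

text \<open>The remainder has order 1 - q at 0, so at s = q the convergence condition reads 1 >
  0.\<close>

lemma
  assumes w: "\<And>i. i \<in> {1..d} \<Longrightarrow> Re (w i) > 0" and q: "q \<in> {1..d}"
  shows J_integrable: "set_integrable lborel {0<..} (J_integrand d w q)"
    and J_integral_eq: "J_integral d w q = rGamma (of_nat q) * mellin (kernel_remainder d w (d - q + 1)) (of_nat q)"
proof -
  obtain C c where "mellin_bound (kernel_remainder d w (d - q + 1)) C (real (d - q + 1) - real d) c"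
    using kernel_remainder_bound[of d w, OF w] by blast
  then have "set_integrable lborel {0<..} (\<lambda>t. of_real t powr (of_nat q - 1) * kernel_remainder d w (d - q + 1) t)"
    using q by (elim mellin_bound.integrable) (auto simp: of_nat_diff)
  also have "?this \<longleftrightarrow> set_integrable lborel {0<..} (J_integrand d w q)"
    using kernel_remainder_J_integrand[OF q] by (intro set_integrable_cong) auto
  finally show "set_integrable lborel {0<..} (J_integrand d w q)" .
  have "mellin (kernel_remainder d w (d - q + 1)) (of_nat q) = set_lebesgue_integral lborel {0<..} (J_integrand d w q)"
    using kernel_remainder_J_integrand[OF q] by (intro set_lebesgue_integral_cong) auto
  then show "J_integral d w q = rGamma (of_nat q) * mellin (kernel_remainder d w (d - q + 1)) (of_nat q)"
    by (simp add: J_integral_def rGamma_inverse_Gamma divide_inverse)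
qed

text \<open>With \<open>N = d - q + 1\<close> the remainder is analytic on Re s > q - 1, a
  neighbourhood of q, and gives J. In every other term q is at most d - k, so the Gamma quotient
  contains the factor 1 / (s - q) exactly once.\<close>

lemma finite_part_hom_barnes_zeta:
  assumes d: "d \<ge> 1" and w: "\<And>i. i \<in> {1..d} \<Longrightarrow> Re (w i) > 0" and q: "q \<in> {1..d}"
  shows "finite_part (hom_barnes_zeta d w) (of_nat q) = J_integral d w q +
     (\<Sum>k\<le>d-q. (-1) ^ k * bernoulli_poly d w k (-1) / fact k / (\<Prod>i=1..d. w i) *
       ((-1) ^ (d - q - k) / (fact (q - 1) * fact (d - q - k)) * (harm (d - q - k) - harm (q - 1))))"
proof -
  define N where "N = d - q + 1"
  have N: "real d - real N = real q - 1" using q by (simp add: N_def of_nat_diff)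
  define f where "f = (\<lambda>s. rGamma s * mellin (kernel_remainder d w N) s)"
  \<comment> \<open>The Gamma quotient without its factor 1 / (s - q); its derivative at q is the
    finite part of the quotient.\<close>
  define u where "u = (\<lambda>m s. \<Prod>j\<in>{1..m}-{q}. 1 / (s - of_nat j) :: complex)"
  define g where "g = (\<lambda>s. \<Sum>k<N. kernel_coeff d w k * u (d - k) s)"
  define u' where "u' = (\<lambda>k. (-1) ^ (d - q - k) / (fact (q - 1) * fact (d - q - k)) * (harm (d - q - k) - harm (q - 1)) :: complex)"
  have u_deriv: "(u (d - k) has_field_derivative u' k) (at (of_nat q))" if k: "k < N" for k
  proof -
    have q': "1 \<le> q" "q \<le> d - k" and e: "d - k - q = d - q - k" using k q by (auto simp: N_def)
    have "(u (d - k) has_field_derivative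
       - (\<Prod>j\<in>{1..d-k}-{q}. 1 / (of_nat q - of_nat j)) * (\<Sum>j\<in>{1..d-k}-{q}. 1 / (of_nat q - of_nat j))) (at (of_nat q))"
      unfolding u_def by (rule has_field_derivative_prod_inverse_linear) auto
    then show ?thesis
      unfolding prod_punctured[OF q'] sum_punctured[OF q'] e u'_def by (simp only: minus_mult_right minus_diff_eq minus_mult_commute)
  qed
  have "finite_part (hom_barnes_zeta d w) (of_nat q) = f (of_nat q) + (\<Sum>k<N. kernel_coeff d w k * u' k)"
  proof (rule finite_part_simple_pole)
    show "f analytic_on {of_nat q}"
      unfolding f_def using N by (intro analytic_intros analytic_mellin_kernel_remainder w) auto
    show "g analytic_on {of_nat q}"
      unfolding g_def u_def by (intro analytic_intros) auto
    show "(g has_field_derivative (\<Sum>k<N. kernel_coeff d w k * u' k)) (at (of_nat q))"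
      unfolding g_def using u_deriv by (auto intro!: derivative_eq_intros simp: mult.commute)
    have "\<forall>\<^sub>F s in at (of_nat q). s \<in> {s. Re s > real q - 1}"
      by (intro eventually_at_in_open' open_halfspace_Re_gt) auto
    moreover have "\<forall>\<^sub>F s in at (of_nat q). hom_barnes_zeta d w s = continuation d w s"
    proof -
      have "continuation d w meromorphic_on {of_nat q}"
        using continuation_meromorphic w by (meson meromorphic_on_subset subset_UNIV)
      moreover have "hom_barnes_zeta d w = remove_sings (continuation d w)"
        using hom_barnes_zeta_eq d w by blast
      ultimately show ?thesis
        by (auto intro: eventually_remove_sings_eq_at meromorphic_on_isolated_singularity)
    qed
    moreover have "\<forall>\<^sub>F s in at (of_nat q). s \<noteq> (of_nat q :: complex)"
      by (rule eventually_neq_at_within)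
    ultimately show "\<forall>\<^sub>F s in at (of_nat q). hom_barnes_zeta d w s = f s + g s / (s - of_nat q)"
    proof eventually_elim
      case (elim s)
      have pos: "Re s > 0" using elim q by auto
      have "hom_barnes_zeta d w s = continuation_piece d w N s"
        using elim continuation_eq_piece[of d w N s, OF w] N by simp
      also have "\<dots> = f s + (\<Sum>k<N. kernel_coeff d w k * (Gamma (s - of_nat (d - k)) * rGamma s))"
      proof -
        have "(\<Sum>k<N. kernel_coeff d w k * Gamma (s - of_nat d + of_nat k)) * rGamma s =
              (\<Sum>k<N. kernel_coeff d w k * (Gamma (s - of_nat (d - k)) * rGamma s))"
          unfolding sum_distrib_right using q
          by (intro sum.cong refl) (auto simp: N_def of_nat_diff algebra_simps)
        then show ?thesis by (simp add: continuation_piece_def f_def algebra_simps)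
      qed
      also have "(\<Sum>k<N. kernel_coeff d w k * (Gamma (s - of_nat (d - k)) * rGamma s)) = g s / (s - of_nat q)"
        unfolding g_def sum_divide_distrib
      proof (intro sum.cong refl)
        fix k assume "k \<in> {..<N}"
        then have "q \<in> {1..d-k}" using q by (auto simp: N_def)
        then have "(\<Prod>j=1..d-k. 1 / (s - of_nat j)) = 1 / (s - of_nat q) * u (d - k) s"
          unfolding u_def by (intro prod.remove) auto
        then show "kernel_coeff d w k * (Gamma (s - of_nat (d - k)) * rGamma s) =
                   kernel_coeff d w k * u (d - k) s / (s - of_nat q)"
          by (simp add: Gamma_mult_rGamma_shift[OF pos])
      qed
      finally show ?case .
    qed
  qed
  also have "f (of_nat q) = J_integral d w q"
    unfolding f_def N_def using J_integral_eq[of d w q, OF w q] by simp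
  also have "(\<Sum>k<N. kernel_coeff d w k * u' k) = (\<Sum>k\<le>d-q. (-1) ^ k * bernoulli_poly d w k (-1) / fact k / (\<Prod>i=1..d. w i) * u' k)"
    using q by (intro sum.cong) (auto simp: N_def kernel_coeff_def)
  finally show ?thesis by (simp only: u'_def)
qed

section \<open>From B_k(-1|w) to B_k(w) by generating functions\<close>

text \<open>Both sides vanish at \<open>0\<close> and have the derivative \<open>(1 - exp (- z)) / z\<close>.\<close>

lemma fps_exp_harm:
  "fps_exp (-1) * Abs_fps (\<lambda>n. harm n / fact n) =
     Abs_fps (\<lambda>n. if n = 0 then 0 else (-1) ^ (n - 1) / (of_nat n * fact n) :: 'a :: {real_normed_field})"
  (is "_ * ?A = ?L")
proof -
  \<comment> \<open>The power series of (exp z - 1) / z.\<close>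
  define D where "D = Abs_fps (\<lambda>n. 1 / fact (Suc n) :: 'a)"
  have A': "fps_deriv ?A = ?A + D"
  proof (rule fps_ext)
    fix n
    have nz: "of_nat (Suc n) \<noteq> (0 :: 'a)" by (rule of_nat_neq_0)
    have "of_nat (Suc n) * harm (Suc n) / fact (Suc n) = (harm (Suc n) / fact n :: 'a)"
      using nz by (simp only: fact_Suc of_nat_mult) (simp add: divide_simps)
    also have "\<dots> = harm n / fact n + 1 / fact (Suc n)"
      using nz by (simp only: fact_Suc of_nat_mult harm_Suc) (simp add: divide_simps)
    finally show "fps_deriv ?A $ n = (?A + D) $ n"
      by (simp add: D_def del: fact_Suc)
  qed
  have XD: "fps_X * D = fps_exp 1 - 1"
  proof (rule fps_ext)
    show "(fps_X * D) $ n = (fps_exp 1 - 1) $ n" for n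
      by (cases n) (auto simp: D_def simp del: fact_Suc)
  qed
  have L': "fps_X * fps_deriv ?L = 1 - fps_exp (-1)"
  proof (rule fps_ext)
    fix n show "(fps_X * fps_deriv ?L) $ n = (1 - fps_exp (-1)) $ n"
      by (cases n) (auto simp del: fact_Suc of_nat_Suc)
  qed
  have "fps_deriv (fps_exp (-1) * ?A) = fps_exp (-1) * D"
    by (simp add: A' algebra_simps fps_const_neg[symmetric] del: fps_const_neg)
  \<comment> \<open>Comparing after multiplication by \<open>fps_X\<close> avoids the division by z;
    the factor can be cancelled again.\<close>
  moreover have "fps_X * (fps_exp (-1) * D) = fps_X * fps_deriv ?L"
  proof -
    have "fps_X * (fps_exp (-1) * D) = fps_exp (-1) * (fps_X * D)" by (simp add: mult_ac)
    also have "\<dots> = fps_exp (-1 + 1) - fps_exp (-1)"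
      unfolding XD fps_exp_add_mult by (simp add: algebra_simps)
    finally show ?thesis unfolding L' by simp
  qed
  ultimately have "fps_deriv (fps_exp (-1) * ?A) = fps_deriv ?L"
    by simp
  then show ?thesis
    unfolding fps_deriv_eq_iff by (simp add: harm_expand)
qed

text \<open>Changing x from -1 to 0 multiplies the generating function by exp z, which gives the
  first identity. In the second, \<open>fps_exp_harm\<close> moves exp (- z) onto the harmonic
  series and so trades the numbers H_(n-k) for the factors 1 / (n - j).\<close>

lemma
  fixes w :: "nat \<Rightarrow> complex"
  shows sum_bernoulli_poly_minus_one:
      "(\<Sum>k\<le>n. bernoulli_poly d w k (-1) / (fact k * fact (n - k))) = bernoulli_num d w n / fact n"
    and sum_bernoulli_poly_minus_one_harm:
      "(\<Sum>k\<le>n. bernoulli_poly d w k (-1) / (fact k * fact (n - k)) * harm (n - k)) =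
       (\<Sum>j<n. (-1) ^ (n - j - 1) * bernoulli_num d w j / (fact j * fact (n - j) * of_nat (n - j)))"
proof -
  let ?F = "bernoulli_fps d w (-1)" and ?E = "bernoulli_fps d w 0"
  have EF: "?F = ?E * fps_exp (-1)" "?E = ?F * fps_exp 1"
    by (simp_all add: bernoulli_fps_def mult_ac flip: fps_exp_add_mult mult.assoc)
  have F: "bernoulli_poly d w k (-1) = fact k * ?F $ k" for k by (simp add: bernoulli_poly_def)
  have E: "bernoulli_num d w k = fact k * ?E $ k" for k by (simp add: bernoulli_num_def bernoulli_poly_def)
  have "?E $ n = (\<Sum>k\<le>n. ?F $ k / fact (n - k))"
    by (subst EF(2)) (simp add: fps_mult_nth atLeast0AtMost)
  then show "(\<Sum>k\<le>n. bernoulli_poly d w k (-1) / (fact k * fact (n - k))) = bernoulli_num d w n / fact n"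
    by (simp add: F E)
  let ?A = "Abs_fps (\<lambda>n. harm n / fact n) :: complex fps"
  have "(\<Sum>k\<le>n. bernoulli_poly d w k (-1) / (fact k * fact (n - k)) * harm (n - k)) = (?F * ?A) $ n"
    by (simp add: fps_mult_nth atLeast0AtMost F)
  also have "?F * ?A = ?E * (fps_exp (-1) * ?A)"
    by (subst EF(1)) (simp add: mult.assoc)
  also have "\<dots> $ n = (\<Sum>j\<le>n. ?E $ j * (if n - j = 0 then 0 else (-1) ^ (n - j - 1) / (of_nat (n - j) * fact (n - j))))"
    unfolding fps_exp_harm by (simp add: fps_mult_nth atLeast0AtMost)
  \<comment> \<open>The term with j = n vanishes, so the sum ends at n - 1.\<close>
  also have "\<dots> = (\<Sum>j<n. (-1) ^ (n - j - 1) * bernoulli_num d w j / (fact j * fact (n - j) * of_nat (n - j)))"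
    by (intro sum.mono_neutral_cong_right) (auto simp: E mult_ac)
  finally show "(\<Sum>k\<le>n. bernoulli_poly d w k (-1) / (fact k * fact (n - k)) * harm (n - k)) =
       (\<Sum>j<n. (-1) ^ (n - j - 1) * bernoulli_num d w j / (fact j * fact (n - j) * of_nat (n - j)))" .
qed

theorem mainTheorem11:
  fixes d q :: nat and w :: "nat \<Rightarrow> complex"
  assumes "d \<ge> 1"
    and "\<And>i. i \<in> {1..d} \<Longrightarrow> Re (w i) > 0"
    and "q \<in> {1..d}"
  shows "set_integrable lborel {0<..} (J_integrand d w q) \<and>
    finite_part (hom_barnes_zeta d w) (of_nat q) =
      1 / ((\<Prod>i=1..d. w i) * fact (q - 1)) *
        ((-1) ^ (d - q + 1) * bernoulli_num d w (d - q) * harm (q - 1) / fact (d - q)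
         + (\<Sum>j<d - q. (-1) ^ (j + 1) * bernoulli_num d w j /
              (fact j * fact (d - q - j) * of_nat (d - q - j))))
      + J_integral d w q"
proof (intro conjI)
  show "set_integrable lborel {0<..} (J_integrand d w q)"
    using J_integrable[of d w q] assms by blast
  define n where "n = d - q"
  define P where "P = (\<Prod>i=1..d. w i)"
  let ?b = "\<lambda>k. bernoulli_poly d w k (-1) / (fact k * fact (n - k))"
  have "(\<Sum>k\<le>n. (-1) ^ k * bernoulli_poly d w k (-1) / fact k / P *
           ((-1) ^ (n - k) / (fact (q - 1) * fact (n - k)) * (harm (n - k) - harm (q - 1)))) =
        (\<Sum>k\<le>n. (-1) ^ n / (P * fact (q - 1)) * (?b k * harm (n - k) - harm (q - 1) * ?b k))"
  proof (intro sum.cong refl)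
    fix k assume "k \<in> {..n}"
    \<comment> \<open>The signs combine to one that does not depend on \<open>k\<close> and can be
      taken out of the sum.\<close>
    then have "(-1) ^ n = (-1) ^ k * (-1 :: complex) ^ (n - k)"
      by (simp flip: power_add)
    then show "(-1) ^ k * bernoulli_poly d w k (-1) / fact k / P *
           ((-1) ^ (n - k) / (fact (q - 1) * fact (n - k)) * (harm (n - k) - harm (q - 1))) =
         (-1) ^ n / (P * fact (q - 1)) * (?b k * harm (n - k) - harm (q - 1) * ?b k)"
      by (simp add: algebra_simps diff_divide_distrib)
  qed
  also have "\<dots> = (-1) ^ n / (P * fact (q - 1)) * ((\<Sum>k\<le>n. ?b k * harm (n - k)) - harm (q - 1) * (\<Sum>k\<le>n. ?b k))"
    by (simp only: sum_distrib_left sum_subtractf right_diff_distrib)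
  also have "\<dots> = 1 / (P * fact (q - 1)) *
      ((-1) ^ (n + 1) * bernoulli_num d w n * harm (q - 1) / fact n +
       (-1) ^ n * (\<Sum>j<n. (-1) ^ (n - j - 1) * bernoulli_num d w j / (fact j * fact (n - j) * of_nat (n - j))))"
    unfolding sum_bernoulli_poly_minus_one sum_bernoulli_poly_minus_one_harm
    by (simp add: algebra_simps diff_divide_distrib)
  also have "(-1) ^ n * (\<Sum>j<n. (-1) ^ (n - j - 1) * bernoulli_num d w j / (fact j * fact (n - j) * of_nat (n - j))) =
             (\<Sum>j<n. (-1) ^ (j + 1) * bernoulli_num d w j / (fact j * fact (n - j) * of_nat (n - j)))"
    unfolding sum_distrib_left
  proof (intro sum.cong refl)
    fix j assume "j \<in> {..<n}"
    \<comment> \<open>The two exponents differ by an even number, so the signs agree.\<close>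
    then have e: "n + (n - j - 1) = (j + 1) + 2 * (n - j - 1)" by simp
    have "(-1) ^ n * (-1) ^ (n - j - 1) = (-1 :: complex) ^ (j + 1)"
      unfolding power_add[symmetric] e by (simp add: power_add)
    then show "(-1) ^ n * ((-1) ^ (n - j - 1) * bernoulli_num d w j / (fact j * fact (n - j) * of_nat (n - j))) =
               (-1) ^ (j + 1) * bernoulli_num d w j / (fact j * fact (n - j) * of_nat (n - j))"
      by (simp only: times_divide_eq_right mult.assoc[symmetric])
  qed
  finally show "finite_part (hom_barnes_zeta d w) (of_nat q) =
      1 / ((\<Prod>i=1..d. w i) * fact (q - 1)) *
        ((-1) ^ (d - q + 1) * bernoulli_num d w (d - q) * harm (q - 1) / fact (d - q)
         + (\<Sum>j<d - q. (-1) ^ (j + 1) * bernoulli_num d w j /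
              (fact j * fact (d - q - j) * of_nat (d - q - j))))
      + J_integral d w q"
    using finite_part_hom_barnes_zeta[of d w q] assms unfolding n_def P_def by (simp add: add.commute)
qed

end
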